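(* For every $k\in\{1,2,\ldots\}$ there is a polyregular function $f:\Sigma^*\to\Gamma^*$ (for some finite alphabets $\Sigma,\Gamma$) whose growth rate is $\Theta(n^2)$ and which is not computed by any $k$-pebble transducer.
   Context: An MSO interpretation $f:\mathcal C\to\mathcal D$ between classes of finite structures is given by components $q\in Q$ with dimensions $\dim(q)\in\{0,1,\ldots\}$, universe formulas $\varphi_q(x_1,\ldots,x_{\dim(q)})$ and, for each output relation $R$ of arity $\ell$ and components $q_1,\ldots,q_\ell$, a formula $\varphi_{R,q_1,\ldots,q_\ell}$ with $\sum_i\dim(q_i)$ free variables; all are MSO formulas over the input vocabulary with first-order free variables. On input $A$ the output universe is $\coprod_{q}\{\bar a\in A^{\dim(q)}: A\models\varphi_q(\bar a)\}$ and $R$ holds of $((q_1,\bar a_1),\ldots,(q_\ell,\bar a_\ell))$ iff $A\models\varphi_{R,q_1,\ldots,q_\ell}(\bar a_1\cdots\bar a_\ell)$. A string-to-string MSO interpretation has type $\Sigma^*\to\Gamma^*$, strings being represented with universe = positions, order $\le$ and unary label predicates $a(x)$; polyregular functions are exactly the functions defined by such interpretations. Growth rate of $f$: $n\mapsto\max\{|f(w)|:|w|\le n\}$. Pebble transducer: for a string-to-string MSO interpretation, call components states; a configuration on input $w$ is a pair (state $q$, tuple $\bar a$ of positions of $w$ of length $\dim(q)$ satisfying $\varphi_q$), i.e. an output position; the tuple is the pebble stack, its length the stack height, its last entry the head. Two configurations on the same input are consecutive if they are consecutive in the order $\le$ of the output string. A pebble transducer is a string-to-string MSO interpretation satisfying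 stack discipline: for any two consecutive configurations, either one pebble stack is a prefix of the other, or both stacks have equal length and agree except possibly on the last entry. A $k$-pebble transducer is a pebble transducer of dimension at most $k$. *)

theory Defs
  imports Main "HOL-Library.Landau_Symbols" "HOL-Library.Sublist"
begin

text \<open>Letters are natural numbers; an alphabet is a finite set of naturals.
  First-order variables and second-order variables are named by naturals.\<close>

datatype mso =
    Lab nat nat
  | Le nat nat
  | Mem nat nat
  | Neg mso
  | Conj mso mso
  | ExFO nat mso
  | ExSO nat mso

fun sat :: "nat list \<Rightarrow> (nat \<Rightarrow> nat) \<Rightarrow> (nat \<Rightarrow> nat set) \<Rightarrow> mso \<Rightarrow> bool" where
  "sat w \<sigma> \<tau> (Lab a x) = (w ! (\<sigma> x) = a)"
| "sat w \<sigma> \<tau> (Le x y) = (\<sigma> x \<le> \<sigma> y)"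
| "sat w \<sigma> \<tau> (Mem x X) = (\<sigma> x \<in> \<tau> X)"
| "sat w \<sigma> \<tau> (Neg \<phi>) = (\<not> sat w \<sigma> \<tau> \<phi>)"
| "sat w \<sigma> \<tau> (Conj \<phi> \<psi>) = (sat w \<sigma> \<tau> \<phi> \<and> sat w \<sigma> \<tau> \<psi>)"
| "sat w \<sigma> \<tau> (ExFO v \<phi>) = (\<exists>p < length w. sat w (\<sigma>(v := p)) \<tau> \<phi>)"
| "sat w \<sigma> \<tau> (ExSO V \<phi>) = (\<exists>P. P \<subseteq> {..<length w} \<and> sat w \<sigma> (\<tau>(V := P)) \<phi>)"

fun fvFO :: "mso \<Rightarrow> nat set" where
  "fvFO (Lab a x) = {x}"
| "fvFO (Le x y) = {x, y}"
| "fvFO (Mem x X) = {x}"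
| "fvFO (Neg \<phi>) = fvFO \<phi>"
| "fvFO (Conj \<phi> \<psi>) = fvFO \<phi> \<union> fvFO \<psi>"
| "fvFO (ExFO v \<phi>) = fvFO \<phi> - {v}"
| "fvFO (ExSO V \<phi>) = fvFO \<phi>"

fun fvSO :: "mso \<Rightarrow> nat set" where
  "fvSO (Lab a x) = {}"
| "fvSO (Le x y) = {}"
| "fvSO (Mem x X) = {X}"
| "fvSO (Neg \<phi>) = fvSO \<phi>"
| "fvSO (Conj \<phi> \<psi>) = fvSO \<phi> \<union> fvSO \<psi>"
| "fvSO (ExFO v \<phi>) = fvSO \<phi>"
| "fvSO (ExSO V \<phi>) = fvSO \<phi> - {V}"

text \<open>A formula with free first-order variables among 0..d-1 (and no free
  second-order variables) evaluated on a tuple xs of positions: variable i is xs!i.\<close>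
definition holds :: "nat list \<Rightarrow> mso \<Rightarrow> nat list \<Rightarrow> bool" where
  "holds w \<phi> xs = sat w (\<lambda>i. if i < length xs then xs ! i else 0) (\<lambda>_. {}) \<phi>"

definition closed_in :: "nat \<Rightarrow> mso \<Rightarrow> bool" where
  "closed_in d \<phi> \<longleftrightarrow> fvFO \<phi> \<subseteq> {..<d} \<and> fvSO \<phi> = {}"

record interp =
  comps :: "nat set"
  dim :: "nat \<Rightarrow> nat"
  univ :: "nat \<Rightarrow> mso"
  ordf :: "nat \<Rightarrow> nat \<Rightarrow> mso"
  labf :: "nat \<Rightarrow> nat \<Rightarrow> mso"

definition wf_interp :: "nat set \<Rightarrow> interp \<Rightarrow> bool" where
  "wf_interp \<Gamma> I \<longleftrightarrow> finite (comps I)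
     \<and> (\<forall>q\<in>comps I. closed_in (dim I q) (univ I q))
     \<and> (\<forall>q1\<in>comps I. \<forall>q2\<in>comps I. closed_in (dim I q1 + dim I q2) (ordf I q1 q2))
     \<and> (\<forall>b\<in>\<Gamma>. \<forall>q\<in>comps I. closed_in (dim I q) (labf I b q))"

definition out_univ :: "interp \<Rightarrow> nat list \<Rightarrow> (nat \<times> nat list) set" where
  "out_univ I w = {(q, xs). q \<in> comps I \<and> length xs = dim I q
      \<and> (\<forall>x\<in>set xs. x < length w) \<and> holds w (univ I q) xs}"

definition out_le :: "interp \<Rightarrow> nat list \<Rightarrow> nat \<times> nat list \<Rightarrow> nat \<times> nat list \<Rightarrow> bool" where
  "out_le I w c d = holds w (ordf I (fst c) (fst d)) (snd c @ snd d)"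

definition out_lab :: "interp \<Rightarrow> nat list \<Rightarrow> nat \<Rightarrow> nat \<times> nat list \<Rightarrow> bool" where
  "out_lab I w b c = holds w (labf I b (fst c)) (snd c)"

definition computes :: "nat set \<Rightarrow> nat set \<Rightarrow> interp \<Rightarrow> (nat list \<Rightarrow> nat list) \<Rightarrow> bool" where
  "computes \<Sigma> \<Gamma> I f \<longleftrightarrow> wf_interp \<Gamma> I \<and> (\<forall>w \<in> lists \<Sigma>. f w \<in> lists \<Gamma> \<and>
     (\<exists>e. bij_betw e {..<length (f w)} (out_univ I w)
        \<and> (\<forall>i < length (f w). \<forall>j < length (f w). i \<le> j \<longleftrightarrow> out_le I w (e i) (e j))
        \<and> (\<forall>i < length (f w). \<forall>b \<in> \<Gamma>. out_lab I w b (e i) \<longleftrightarrow> b = f w ! i)))"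

definition polyregular :: "nat set \<Rightarrow> nat set \<Rightarrow> (nat list \<Rightarrow> nat list) \<Rightarrow> bool" where
  "polyregular \<Sigma> \<Gamma> f \<longleftrightarrow> (\<exists>I. computes \<Sigma> \<Gamma> I f)"

definition consecutive :: "interp \<Rightarrow> nat list \<Rightarrow> nat \<times> nat list \<Rightarrow> nat \<times> nat list \<Rightarrow> bool" where
  "consecutive I w c d \<longleftrightarrow> c \<in> out_univ I w \<and> d \<in> out_univ I w \<and> c \<noteq> d \<and> out_le I w c d
     \<and> \<not> (\<exists>m\<in>out_univ I w. m \<noteq> c \<and> m \<noteq> d \<and> out_le I w c m \<and> out_le I w m d)"

definition stack_discipline :: "nat set \<Rightarrow> interp \<Rightarrow> bool" where
  "stack_discipline \<Sigma> I \<longleftrightarrow> (\<forall>w \<in> lists \<Sigma>. \<forall>c d. consecutive I w c d \<longrightarrow>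
      (prefix (snd c) (snd d) \<or> prefix (snd d) (snd c)
       \<or> (length (snd c) = length (snd d) \<and> butlast (snd c) = butlast (snd d))))"

definition k_pebble_computes :: "nat \<Rightarrow> nat set \<Rightarrow> nat set \<Rightarrow> interp \<Rightarrow> (nat list \<Rightarrow> nat list) \<Rightarrow> bool" where
  "k_pebble_computes k \<Sigma> \<Gamma> I f \<longleftrightarrow> computes \<Sigma> \<Gamma> I f \<and> stack_discipline \<Sigma> I
     \<and> (\<forall>q\<in>comps I. dim I q \<le> k)"

definition growth :: "nat set \<Rightarrow> (nat list \<Rightarrow> nat list) \<Rightarrow> nat \<Rightarrow> nat" where
  "growth \<Sigma> f n = Max ((\<lambda>w. length (f w)) ` {w \<in> lists \<Sigma>. length w \<le> n})"

end

theory Submission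
  imports Defs "HOL-Library.List_Lexorder"
begin

text \<open>Letters are ranks 0, ..., m with m = k + 1; a letter at most j ends a level-j block. The function
  outputs all pairs (x, y) of positions, ordered lexicographically by the level-0 blocks of x and y,
  then by their level-1 blocks, and so on, with the larger of the two letters as label. The pairs in
  a given pair of level-j blocks form a cell, which is an interval of the output.

  On a word whose level-j blocks all have length s j, with s j much larger than s (j + 1), suppose
  that all stacks in some level-h cell have height at least h. Then their first h - 1 entries do not
  change in the cell. By pumping, the last entries of the stacks of height exactly h visit only a
  constant number of level-h blocks, so there are at most O(s h) such stacks. The cell has
  \<open>(s h / s (h + 1))\<^sup>2\<close> subcells, which is more, so in one of them all stacks have height at least h + 1.
  Hence stacks of height k + 1 occur.\<close>

section \<open>Recognisable languages\<close>

text \<open>The transducer is arbitrary: its configurations need not resemble pairs of positions,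
  and all that ties them to the cells is the output string. The labels are chosen for this reason.
  On a word that ends in 0, a label at most j occurs exactly at the last pair of each level-j cell,
  so two configurations lie in one level-j cell iff no such label is output from the earlier one on
  and before the later one. This is an MSO property of the two configurations and the input, hence
  recognisable, hence open to pumping. If heads over one fixed stack visit too many level-j blocks
  within a cell, two of them lie in different blocks and the factor between them contains the end of
  a block. Repeating it leaves the block lengths at most the length of the original word, so cells
  stay bounded by its square, while each copy contributes a further configuration to the same cell.
  Interleaving both components in the key makes a cell a product of two blocks. Its number of
  subcells is therefore the square of the ratio of block lengths, whereas the number of head
  positions is only linear in the block length.\<close>

definition rec_lang :: "('a list \<Rightarrow> bool) \<Rightarrow> bool" where
  "rec_lang L \<longleftrightarrow> (\<exists>h::'a list \<Rightarrow> nat. finite (range h)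
     \<and> (\<forall>u u' v v'. h u = h u' \<longrightarrow> h v = h v' \<longrightarrow> h (u @ v) = h (u' @ v'))
     \<and> (\<forall>u u'. h u = h u' \<longrightarrow> L u = L u'))"

text \<open>Finitely many classes can be numbered, so classes of any type may be used although the
  definition fixes natural numbers. Recognition is meant in the sense of a congruence of finite
  index; the constructions below use pairs and sets of classes.\<close>

lemma rec_langI:
  fixes h :: "'a list \<Rightarrow> 'b"
  assumes fin: "finite (range h)"
    and cong: "\<And>u u' v v'. h u = h u' \<Longrightarrow> h v = h v' \<Longrightarrow> h (u @ v) = h (u' @ v')"
    and sat: "\<And>u u'. h u = h u' \<Longrightarrow> L u = L u'"
  shows "rec_lang L"
proof -
  obtain g :: "'b \<Rightarrow> nat" where g: "inj_on g (range h)"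
    using finite_imp_inj_to_nat_seg[OF fin] by blast
  have eq: "g (h u) = g (h v) \<longleftrightarrow> h u = h v" for u v
    using g by (auto simp: inj_on_def)
  have "finite (range (g \<circ> h))"
    using fin by (metis finite_imageI image_comp)
  then show ?thesis
    unfolding rec_lang_def
  proof (intro exI[of _ "g \<circ> h"] conjI allI impI)
    fix u u' v v'
    assume "(g \<circ> h) u = (g \<circ> h) u'" "(g \<circ> h) v = (g \<circ> h) v'"
    then have "h (u @ v) = h (u' @ v')"
      by (intro cong) (simp_all add: eq)
    then show "(g \<circ> h) (u @ v) = (g \<circ> h) (u' @ v')" by simp
  next
    fix u u'
    assume "(g \<circ> h) u = (g \<circ> h) u'"
    then show "L u = L u'"
      by (intro sat) (simp add: eq)
  qed
qed

lemma rec_lang_not: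
  assumes "rec_lang L"
  shows "rec_lang (\<lambda>W. \<not> L W)"
  using assms unfolding rec_lang_def by simp

lemma rec_lang_conj:
  fixes L K :: "'a list \<Rightarrow> bool"
  assumes "rec_lang L" "rec_lang K"
  shows "rec_lang (\<lambda>W. L W \<and> K W)"
proof -
  obtain h :: "'a list \<Rightarrow> nat" where h: "finite (range h)"
    "\<And>u u' v v'. h u = h u' \<Longrightarrow> h v = h v' \<Longrightarrow> h (u @ v) = h (u' @ v')"
    "\<And>u u'. h u = h u' \<Longrightarrow> L u = L u'"
    using assms(1) unfolding rec_lang_def by blast
  obtain g :: "'a list \<Rightarrow> nat" where g: "finite (range g)"
    "\<And>u u' v v'. g u = g u' \<Longrightarrow> g v = g v' \<Longrightarrow> g (u @ v) = g (u' @ v')"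
    "\<And>u u'. g u = g u' \<Longrightarrow> K u = K u'"
    using assms(2) unfolding rec_lang_def by blast
  have "finite (range (\<lambda>u. (h u, g u)))"
    by (rule finite_subset[of _ "range h \<times> range g"]) (use h(1) g(1) in auto)
  then show ?thesis
  proof (rule rec_langI)
    fix u u' v v'
    assume "(h u, g u) = (h u', g u')" "(h v, g v) = (h v', g v')"
    then show "(h (u @ v), g (u @ v)) = (h (u' @ v'), g (u' @ v'))"
      using h(2)[of u u' v v'] g(2)[of u u' v v'] by simp
  next
    fix u u'
    assume "(h u, g u) = (h u', g u')"
    then show "(L u \<and> K u) = (L u' \<and> K u')"
      using h(3)[of u u'] g(3)[of u u'] by simp
  qed
qed

lemma rec_lang_relabel:
  fixes L :: "'b list \<Rightarrow> bool" and g :: "'a \<Rightarrow> 'b"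
  assumes "rec_lang L"
  shows "rec_lang (\<lambda>W. L (map g W))"
proof -
  obtain h :: "'b list \<Rightarrow> nat" where h: "finite (range h)"
    "\<And>u u' v v'. h u = h u' \<Longrightarrow> h v = h v' \<Longrightarrow> h (u @ v) = h (u' @ v')"
    "\<And>u u'. h u = h u' \<Longrightarrow> L u = L u'"
    using assms unfolding rec_lang_def by blast
  have "finite (range (\<lambda>W. h (map g W)))"
    by (rule finite_subset[OF _ h(1)]) auto
  then show ?thesis
  proof (rule rec_langI)
    fix u u' v v'
    assume "h (map g u) = h (map g u')" "h (map g v) = h (map g v')"
    from h(2)[OF this] show "h (map g (u @ v)) = h (map g (u' @ v'))"
      by simp
  qed (rule h(3))
qed

text \<open>Subset construction: the class of a word is the set of classes of all words letterwise
  related to it. Every word related to \<open>u @ v\<close> splits into one related to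
  \<open>u\<close> and one related to \<open>v\<close>, which gives the congruence. Both kinds of
  quantifiers reduce to this lemma.\<close>

lemma rec_lang_project:
  fixes L :: "'b list \<Rightarrow> bool" and R :: "'a \<Rightarrow> 'b \<Rightarrow> bool"
  assumes "rec_lang L"
  shows "rec_lang (\<lambda>W. \<exists>W'. list_all2 R W W' \<and> L W')"
proof -
  obtain h :: "'b list \<Rightarrow> nat" where h: "finite (range h)"
    "\<And>u u' v v'. h u = h u' \<Longrightarrow> h v = h v' \<Longrightarrow> h (u @ v) = h (u' @ v')"
    "\<And>u u'. h u = h u' \<Longrightarrow> L u = L u'"
    using assms unfolding rec_lang_def by blast
  define H where "H W = h ` {W'. list_all2 R W W'}" for W
  have sub: "H (u @ v) \<subseteq> H (u' @ v')" if "H u = H u'" "H v = H v'" for u u' v v'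
  proof
    fix x assume "x \<in> H (u @ v)"
    then obtain a b where ab: "list_all2 R u a" "list_all2 R v b" "x = h (a @ b)"
      by (auto simp: H_def list_all2_append1)
    have "h a \<in> H u" "h b \<in> H v"
      using ab by (auto simp: H_def)
    then have "h a \<in> H u'" "h b \<in> H v'"
      by (simp_all only: that)
    then obtain a' b' where "list_all2 R u' a'" "h a = h a'" "list_all2 R v' b'" "h b = h b'"
      unfolding H_def by blast
    then have "list_all2 R (u' @ v') (a' @ b')" "x = h (a' @ b')"
      using ab(3) h(2)[of a a' b b'] by (simp_all add: list_all2_appendI)
    then show "x \<in> H (u' @ v')"
      unfolding H_def by blast
  qed
  have "finite (range H)"
    by (rule finite_subset[of _ "Pow (range h)"]) (use h(1) in \<open>auto simp: H_def\<close>)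
  then show ?thesis
  proof (rule rec_langI)
    show "H (u @ v) = H (u' @ v')" if "H u = H u'" "H v = H v'" for u u' v v'
      using sub[OF that] sub[OF that[symmetric]] by blast
  next
    have "(\<exists>W'. list_all2 R u' W' \<and> L W')" if eq: "H u = H u'" and L: "list_all2 R u W" "L W" for u u' W
    proof -
      have "h W \<in> H u"
        using L(1) by (auto simp: H_def)
      then obtain W' where "list_all2 R u' W'" "h W = h W'"
        unfolding eq by (auto simp: H_def)
      then show ?thesis
        using L(2) h(3)[of W W'] by blast
    qed
    then show "(\<exists>W'. list_all2 R u W' \<and> L W') = (\<exists>W'. list_all2 R u' W' \<and> L W')" if "H u = H u'" for u u'
      using that by metis
  qed
qed

lemma rec_lang_exists_letter: "rec_lang (\<lambda>W. \<exists>x\<in>set W. P x)"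
  by (rule rec_langI[where h = "\<lambda>W. \<exists>x\<in>set W. P x"]) auto

text \<open>The only primitive that looks at the order of letters. It serves both for the atomic
  formula comparing two positions and, with \<open>P = Q\<close>, for saying that a mark does not
  occur twice.\<close>

definition letters_before :: "('a \<Rightarrow> bool) \<Rightarrow> ('a \<Rightarrow> bool) \<Rightarrow> 'a list \<Rightarrow> bool" where
  "letters_before P Q W \<longleftrightarrow> (\<exists>i j. i < j \<and> j < length W \<and> P (W ! i) \<and> Q (W ! j))"

lemma letters_before_append:
  "letters_before P Q (u @ v) \<longleftrightarrow> letters_before P Q u \<or> letters_before P Q v
     \<or> (\<exists>x\<in>set u. P x) \<and> (\<exists>x\<in>set v. Q x)" (is "?l \<longleftrightarrow> ?r")
proof
  assume ?l
  then obtain i j where ij: "i < j" "j < length u + length v" "P ((u @ v) ! i)" "Q ((u @ v) ! j)"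
    by (auto simp: letters_before_def)
  consider "j < length u" | "i < length u" "length u \<le> j" | "length u \<le> i"
    using ij by linarith
  then show ?r
  proof cases
    case 1
    then show ?thesis using ij by (auto simp: letters_before_def nth_append)
  next
    case 2
    have "P (u ! i)" "Q (v ! (j - length u))" "j - length u < length v"
      using 2 ij by (auto simp: nth_append)
    then show ?thesis using 2 nth_mem by blast
  next
    case 3
    have "letters_before P Q v"
      unfolding letters_before_def
      by (rule exI[of _ "i - length u"], rule exI[of _ "j - length u"])
        (use 3 ij in \<open>auto simp: nth_append\<close>)
    then show ?thesis by blast
  qed
next
  assume ?r
  then consider (a) i j where "i < j" "j < length u" "P (u ! i)" "Q (u ! j)"
    | (b) i j where "i < j" "j < length v" "P (v ! i)" "Q (v ! j)"
    | (c) i j where "i < length u" "j < length v" "P (u ! i)" "Q (v ! j)"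
    by (auto simp: letters_before_def in_set_conv_nth)
  then show ?l
  proof cases
    case a
    then show ?thesis
      unfolding letters_before_def
      by (intro exI[of _ i] exI[of _ j]) (auto simp: nth_append)
  next
    case b
    then show ?thesis
      unfolding letters_before_def
      by (intro exI[of _ "length u + i"] exI[of _ "length u + j"]) auto
  next
    case c
    then show ?thesis
      unfolding letters_before_def
      by (intro exI[of _ i] exI[of _ "length u + j"]) (auto simp: nth_append)
  qed
qed

lemma rec_lang_letters_before: "rec_lang (letters_before P Q)"
  by (rule rec_langI[where
        h = "\<lambda>W. (letters_before P Q W, \<exists>x\<in>set W. P x, \<exists>x\<in>set W. Q x)"])
    (simp_all only: letters_before_append set_append bex_Un prod.inject finite)

section \<open>Relations between positions of a word\<close>

text \<open>An input word with an assignment is a word whose letters carry sets of tracks: \<open>Inl x\<close> for the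
  first-order variable x, which marks one position, and \<open>Inr X\<close> for the second-order variable X.\<close>

definition encw :: "nat list \<Rightarrow> (nat \<Rightarrow> (nat + nat) set) \<Rightarrow> (nat \<times> (nat + nat) set) list" where
  "encw w S = map (\<lambda>p. (w ! p, S p)) [0..<length w]"

definition marks :: "nat set \<Rightarrow> (nat \<Rightarrow> nat) \<Rightarrow> (nat \<Rightarrow> nat set) \<Rightarrow> nat \<Rightarrow> (nat + nat) set" where
  "marks V \<sigma> \<tau> p = {Inl x |x. x \<in> V \<and> \<sigma> x = p} \<union> {Inr X |X. p \<in> \<tau> X}"

text \<open>\<open>V\<close> limits the first-order tracks only: a first-order variable needs
  exactly one mark inside the word, so its value must be in range, while a second-order track may be
  any set and is always present.\<close>

definition rec_rel :: "nat set \<Rightarrow> (nat list \<Rightarrow> (nat \<Rightarrow> nat) \<Rightarrow> (nat \<Rightarrow> nat set) \<Rightarrow> bool) \<Rightarrow> bool" where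
  "rec_rel V A \<longleftrightarrow> (\<exists>L. rec_lang L \<and>
     (\<forall>w \<sigma> \<tau>. (\<forall>x\<in>V. \<sigma> x < length w) \<longrightarrow> A w \<sigma> \<tau> = L (encw w (marks V \<sigma> \<tau>))))"

lemma rec_relI:
  assumes "rec_lang L"
    and "\<And>w \<sigma> \<tau>. (\<And>x. x \<in> V \<Longrightarrow> \<sigma> x < length w) \<Longrightarrow> A w \<sigma> \<tau> = L (encw w (marks V \<sigma> \<tau>))"
  shows "rec_rel V A"
  unfolding rec_rel_def by (rule exI[of _ L]) (simp add: assms)

lemma length_encw [simp]: "length (encw w S) = length w"
  by (simp add: encw_def)

lemma nth_encw [simp]: "p < length w \<Longrightarrow> encw w S ! p = (w ! p, S p)"
  by (simp add: encw_def)

lemma ex_set_encw: "(\<exists>a\<in>set (encw w S). P a) \<longleftrightarrow> (\<exists>p<length w. P (w ! p, S p))"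
  by (auto simp: encw_def)

lemma rec_rel_not:
  assumes "rec_rel V A"
  shows "rec_rel V (\<lambda>w \<sigma> \<tau>. \<not> A w \<sigma> \<tau>)"
proof -
  obtain L where L: "rec_lang L"
    "\<And>w \<sigma> \<tau>. (\<And>x. x \<in> V \<Longrightarrow> \<sigma> x < length w) \<Longrightarrow> A w \<sigma> \<tau> = L (encw w (marks V \<sigma> \<tau>))"
    using assms unfolding rec_rel_def by blast
  show ?thesis
    by (rule rec_relI[OF rec_lang_not[OF L(1)]]) (use L(2) in auto)
qed

lemma rec_rel_conj:
  assumes "rec_rel V A" "rec_rel V B"
  shows "rec_rel V (\<lambda>w \<sigma> \<tau>. A w \<sigma> \<tau> \<and> B w \<sigma> \<tau>)"
proof -
  obtain L where L: "rec_lang L"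
    "\<And>w \<sigma> \<tau>. (\<And>x. x \<in> V \<Longrightarrow> \<sigma> x < length w) \<Longrightarrow> A w \<sigma> \<tau> = L (encw w (marks V \<sigma> \<tau>))"
    using assms(1) unfolding rec_rel_def by blast
  obtain K where K: "rec_lang K"
    "\<And>w \<sigma> \<tau>. (\<And>x. x \<in> V \<Longrightarrow> \<sigma> x < length w) \<Longrightarrow> B w \<sigma> \<tau> = K (encw w (marks V \<sigma> \<tau>))"
    using assms(2) unfolding rec_rel_def by blast
  show ?thesis
    by (rule rec_relI[OF rec_lang_conj[OF L(1) K(1)]]) (use L(2) K(2) in auto)
qed

lemma rec_rel_disj:
  assumes "rec_rel V A" "rec_rel V B"
  shows "rec_rel V (\<lambda>w \<sigma> \<tau>. A w \<sigma> \<tau> \<or> B w \<sigma> \<tau>)"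
  using rec_rel_not[OF rec_rel_conj[OF assms[THEN rec_rel_not]]] by simp

lemma rec_rel_bex:
  assumes "finite B" "\<And>b. b \<in> B \<Longrightarrow> rec_rel V (A b)"
  shows "rec_rel V (\<lambda>w \<sigma> \<tau>. \<exists>b\<in>B. A b w \<sigma> \<tau>)"
  using assms
proof (induction B)
  case empty
  have "rec_lang (\<lambda>W::(nat \<times> (nat + nat) set) list. \<exists>x\<in>set W. False)"
    by (rule rec_lang_exists_letter)
  then show ?case
    by (intro rec_relI) auto
next
  case (insert b B)
  then show ?case
    by (simp add: rec_rel_disj)
qed

lemma list_all2_encw:
  "list_all2 R (encw w S) W \<longleftrightarrow> length W = length w \<and> (\<forall>p<length w. R (w ! p, S p) (W ! p))"
  by (auto simp: list_all2_conv_all_nth)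

text \<open>Guessing p means projecting away track v. The relation \<open>R\<close> ignores that
  track on both sides, so an outer variable of the same name is overwritten; \<open>K\<close>
  demands exactly one mark on it, which makes the guessed word the encoding for one
  position.\<close>

lemma rec_rel_ex_FO:
  assumes "rec_rel (insert v V) A"
  shows "rec_rel V (\<lambda>w \<sigma> \<tau>. \<exists>p<length w. A w (\<sigma>(v := p)) \<tau>)"
proof -
  obtain L where L: "rec_lang L"
    "\<And>w \<sigma> \<tau>. (\<And>x. x \<in> insert v V \<Longrightarrow> \<sigma> x < length w) \<Longrightarrow>
      A w \<sigma> \<tau> = L (encw w (marks (insert v V) \<sigma> \<tau>))"
    using assms unfolding rec_rel_def by blast
  define Q where "Q = (\<lambda>a::nat \<times> (nat + nat) set. Inl v \<in> snd a)"
  define R where "R = (\<lambda>(a::nat \<times> (nat + nat) set) (b::nat \<times> (nat + nat) set).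
    fst a = fst b \<and> snd a - {Inl v} = snd b - {Inl v})"
  define K where "K W \<longleftrightarrow> ((\<exists>a\<in>set W. Q a) \<and> \<not> letters_before Q Q W) \<and> L W" for W
  have "rec_lang K"
    unfolding K_def
    by (intro rec_lang_conj rec_lang_not rec_lang_exists_letter rec_lang_letters_before L(1))
  then have rec: "rec_lang (\<lambda>W. \<exists>W'. list_all2 R W W' \<and> K W')"
    by (rule rec_lang_project)
  show ?thesis
  proof (rule rec_relI[OF rec])
    fix w :: "nat list" and \<sigma> :: "nat \<Rightarrow> nat" and \<tau> :: "nat \<Rightarrow> nat set"
    assume \<sigma>: "\<And>x. x \<in> V \<Longrightarrow> \<sigma> x < length w"
    let ?E = "\<lambda>p. encw w (marks (insert v V) (\<sigma>(v := p)) \<tau>)"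
    have A: "A w (\<sigma>(v := p)) \<tau> = L (?E p)" if "p < length w" for p
      using that \<sigma> by (intro L(2)) auto
    have Q: "Q (?E p ! i) \<longleftrightarrow> i = p" if "i < length w" for p i
      using that by (auto simp: Q_def marks_def)
    have K: "K (?E p) \<longleftrightarrow> L (?E p)" if "p < length w" for p
    proof -
      have "?E p ! p \<in> set (?E p)"
        using that by (intro nth_mem) simp
      moreover have "Q (?E p ! p)"
        using that Q by blast
      moreover have "\<not> letters_before Q Q (?E p)"
        unfolding letters_before_def using Q by (metis length_encw less_irrefl less_trans)
      ultimately show ?thesis
        unfolding K_def by blast
    qed
    show "(\<exists>p<length w. A w (\<sigma>(v := p)) \<tau>) \<longleftrightarrow>
      (\<exists>W'. list_all2 R (encw w (marks V \<sigma> \<tau>)) W' \<and> K W')"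
    proof
      assume "\<exists>p<length w. A w (\<sigma>(v := p)) \<tau>"
      then obtain p where p: "p < length w" "A w (\<sigma>(v := p)) \<tau>" by blast
      have "list_all2 R (encw w (marks V \<sigma> \<tau>)) (?E p)"
        by (auto simp: list_all2_encw R_def marks_def)
      then show "\<exists>W'. list_all2 R (encw w (marks V \<sigma> \<tau>)) W' \<and> K W'"
        using p A K by blast
    next
      assume "\<exists>W'. list_all2 R (encw w (marks V \<sigma> \<tau>)) W' \<and> K W'"
      then obtain W where len: "length W = length w"
        and R: "\<And>i. i < length w \<Longrightarrow> R (w ! i, marks V \<sigma> \<tau> i) (W ! i)" and KW: "K W"
        by (auto simp: list_all2_encw)
      from KW obtain p where p: "p < length w" "Q (W ! p)"
        by (auto simp: K_def in_set_conv_nth len)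
      have uniq: "Q (W ! i) \<longleftrightarrow> i = p" if "i < length w" for i
        using KW p that len by (auto simp: K_def letters_before_def) (metis linorder_neqE_nat)
      have "W = ?E p"
      proof (rule nth_equalityI)
        fix i assume i: "i < length W"
        then have i': "i < length w" using len by simp
        have "snd (W ! i) = (snd (W ! i) - {Inl v}) \<union> {t. t = Inl v \<and> i = p}"
          using uniq[OF i'] by (auto simp: Q_def)
        also have "\<dots> = (marks V \<sigma> \<tau> i - {Inl v}) \<union> {t. t = Inl v \<and> i = p}"
          using R[OF i'] by (auto simp: R_def)
        also have "\<dots> = marks (insert v V) (\<sigma>(v := p)) \<tau> i"
          by (auto simp: marks_def)
        finally show "W ! i = ?E p ! i"
          using R[OF i'] i' by (auto simp: R_def prod_eq_iff)
      qed (simp add: len)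
      then show "\<exists>p<length w. A w (\<sigma>(v := p)) \<tau>"
        using KW p(1) A by (auto simp: K_def)
    qed
  qed
qed

text \<open>As for positions, but every set of marks on track X encodes an admissible set, so
  nothing has to be imposed on the guessed word.\<close>

lemma rec_rel_ex_SO:
  assumes "rec_rel V A"
  shows "rec_rel V (\<lambda>w \<sigma> \<tau>. \<exists>P. P \<subseteq> {..<length w} \<and> A w \<sigma> (\<tau>(X := P)))"
proof -
  obtain L where L: "rec_lang L"
    "\<And>w \<sigma> \<tau>. (\<And>x. x \<in> V \<Longrightarrow> \<sigma> x < length w) \<Longrightarrow> A w \<sigma> \<tau> = L (encw w (marks V \<sigma> \<tau>))"
    using assms unfolding rec_rel_def by blast
  define R where "R = (\<lambda>(a::nat \<times> (nat + nat) set) (b::nat \<times> (nat + nat) set).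
    fst a = fst b \<and> snd a - {Inr X} = snd b - {Inr X})"
  show ?thesis
  proof (rule rec_relI[OF rec_lang_project[OF L(1), of R]])
    fix w :: "nat list" and \<sigma> :: "nat \<Rightarrow> nat" and \<tau> :: "nat \<Rightarrow> nat set"
    assume \<sigma>: "\<And>x. x \<in> V \<Longrightarrow> \<sigma> x < length w"
    let ?E = "\<lambda>P. encw w (marks V \<sigma> (\<tau>(X := P)))"
    have A: "A w \<sigma> (\<tau>(X := P)) = L (?E P)" for P
      using \<sigma> by (intro L(2)) auto
    show "(\<exists>P. P \<subseteq> {..<length w} \<and> A w \<sigma> (\<tau>(X := P))) \<longleftrightarrow>
      (\<exists>W'. list_all2 R (encw w (marks V \<sigma> \<tau>)) W' \<and> L W')"
    proof
      assume "\<exists>P. P \<subseteq> {..<length w} \<and> A w \<sigma> (\<tau>(X := P))"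
      then obtain P where "A w \<sigma> (\<tau>(X := P))" by blast
      moreover have "list_all2 R (encw w (marks V \<sigma> \<tau>)) (?E P)"
        by (auto simp: list_all2_encw R_def marks_def)
      ultimately show "\<exists>W'. list_all2 R (encw w (marks V \<sigma> \<tau>)) W' \<and> L W'"
        using A by blast
    next
      assume "\<exists>W'. list_all2 R (encw w (marks V \<sigma> \<tau>)) W' \<and> L W'"
      then obtain W where len: "length W = length w"
        and R: "\<And>i. i < length w \<Longrightarrow> R (w ! i, marks V \<sigma> \<tau> i) (W ! i)" and LW: "L W"
        by (auto simp: list_all2_encw)
      define P where "P = {i. i < length w \<and> Inr X \<in> snd (W ! i)}"
      have "W = ?E P"
      proof (rule nth_equalityI)
        fix i assume i: "i < length W"
        then have i': "i < length w" using len by simp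
        have "snd (W ! i) = (snd (W ! i) - {Inr X}) \<union> {t. t = Inr X \<and> i \<in> P}"
          using i' by (auto simp: P_def)
        also have "\<dots> = (marks V \<sigma> \<tau> i - {Inr X}) \<union> {t. t = Inr X \<and> i \<in> P}"
          using R[OF i'] by (auto simp: R_def)
        also have "\<dots> = marks V \<sigma> (\<tau>(X := P)) i"
          by (auto simp: marks_def)
        finally show "W ! i = ?E P ! i"
          using R[OF i'] i' by (auto simp: R_def prod_eq_iff)
      qed (simp add: len)
      then have "A w \<sigma> (\<tau>(X := P))"
        using LW A by simp
      moreover have "P \<subseteq> {..<length w}"
        by (auto simp: P_def)
      ultimately show "\<exists>P. P \<subseteq> {..<length w} \<and> A w \<sigma> (\<tau>(X := P))" by blast
    qed
  qed
qed

lemma rec_rel_sat: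
  assumes "fvFO \<phi> \<subseteq> V"
  shows "rec_rel V (\<lambda>w \<sigma> \<tau>. sat w \<sigma> \<tau> \<phi>)"
  using assms
proof (induction \<phi> arbitrary: V)
  case (Lab a x)
  show ?case
    by (rule rec_relI[OF rec_lang_exists_letter[of "\<lambda>b. fst b = a \<and> Inl x \<in> snd b"]])
      (use Lab in \<open>auto simp: ex_set_encw marks_def\<close>)
next
  case (Le x y)
  define Px where "Px = (\<lambda>b::nat \<times> (nat + nat) set. Inl x \<in> snd b)"
  define Py where "Py = (\<lambda>b::nat \<times> (nat + nat) set. Inl y \<in> snd b)"
  have "rec_lang (\<lambda>W. \<not> letters_before Py Px W)"
    by (intro rec_lang_not rec_lang_letters_before)
  then show ?case
  proof (rule rec_relI)
    fix w :: "nat list" and \<sigma> :: "nat \<Rightarrow> nat" and \<tau> :: "nat \<Rightarrow> nat set"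
    assume \<sigma>: "\<And>z. z \<in> V \<Longrightarrow> \<sigma> z < length w"
    have "x \<in> V" "y \<in> V"
      using Le by auto
    then have "Px (encw w (marks V \<sigma> \<tau>) ! i) \<longleftrightarrow> i = \<sigma> x"
      "Py (encw w (marks V \<sigma> \<tau>) ! i) \<longleftrightarrow> i = \<sigma> y" if "i < length w" for i
      using that by (auto simp: Px_def Py_def marks_def)
    then have "letters_before Py Px (encw w (marks V \<sigma> \<tau>)) \<longleftrightarrow> \<sigma> y < \<sigma> x"
      using \<sigma>[OF \<open>x \<in> V\<close>] unfolding letters_before_def
      by (metis length_encw less_trans)
    then show "sat w \<sigma> \<tau> (Le x y) \<longleftrightarrow> \<not> letters_before Py Px (encw w (marks V \<sigma> \<tau>))"
      by auto
  qed
next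
  case (Mem x X)
  show ?case
    by (rule rec_relI[OF rec_lang_exists_letter[of "\<lambda>b. Inl x \<in> snd b \<and> Inr X \<in> snd b"]])
      (use Mem in \<open>auto simp: ex_set_encw marks_def\<close>)
next
  case (Neg \<phi>)
  then show ?case by (simp add: rec_rel_not)
next
  case (Conj \<phi> \<psi>)
  then show ?case by (simp add: rec_rel_conj)
next
  case (ExFO v \<phi>)
  then have "rec_rel (insert v V) (\<lambda>w \<sigma> \<tau>. sat w \<sigma> \<tau> \<phi>)"
    by (intro ExFO.IH) auto
  from rec_rel_ex_FO[OF this] show ?case by simp
next
  case (ExSO X \<phi>)
  then have "rec_rel V (\<lambda>w \<sigma> \<tau>. sat w \<sigma> \<tau> \<phi>)"
    by simp
  from rec_rel_ex_SO[OF this] show ?case by simp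
qed

text \<open>\<open>holds\<close> insists on the variables 0, 1, ... for the entries of the tuple.
  The relabelling \<open>g\<close> copies track \<open>xs ! i\<close> to track \<open>i\<close>, so
  an arbitrary and possibly repeating list of variables can be substituted; it drops the
  second-order tracks because \<open>holds\<close> evaluates with empty sets.\<close>

lemma rec_rel_holds:
  assumes "closed_in (length xs) \<phi>" "set xs \<subseteq> V"
  shows "rec_rel V (\<lambda>w \<sigma> \<tau>. holds w \<phi> (map \<sigma> xs))"
proof -
  define d where "d = length xs"
  have "rec_rel {..<d} (\<lambda>w \<sigma> \<tau>. sat w \<sigma> \<tau> \<phi>)"
    using assms(1) by (intro rec_rel_sat) (auto simp: closed_in_def d_def)
  then obtain L where L: "rec_lang L" "\<And>w \<sigma> \<tau>. (\<And>x. x \<in> {..<d} \<Longrightarrow> \<sigma> x < length w) \<Longrightarrow>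
      sat w \<sigma> \<tau> \<phi> = L (encw w (marks {..<d} \<sigma> \<tau>))"
    unfolding rec_rel_def by blast
  define g where "g = (\<lambda>b::nat \<times> (nat + nat) set.
    (fst b, {Inl i |i. i < d \<and> Inl (xs ! i) \<in> snd b} :: (nat + nat) set))"
  show ?thesis
  proof (rule rec_relI[OF rec_lang_relabel[OF L(1), of g]])
    fix w :: "nat list" and \<sigma> and \<tau> :: "nat \<Rightarrow> nat set"
    assume \<sigma>: "\<And>x. x \<in> V \<Longrightarrow> \<sigma> x < length w"
    let ?\<sigma> = "\<lambda>i. if i < length (map \<sigma> xs) then map \<sigma> xs ! i else 0"
    have in_V: "xs ! i \<in> V" if "i < d" for i
      using that assms(2) by (auto simp: d_def)
    have "holds w \<phi> (map \<sigma> xs) = L (encw w (marks {..<d} ?\<sigma> (\<lambda>_. {})))"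
      unfolding holds_def using \<sigma> in_V by (intro L(2)) (auto simp: d_def)
    also have "encw w (marks {..<d} ?\<sigma> (\<lambda>_. {})) = map g (encw w (marks V \<sigma> \<tau>))"
      by (rule nth_equalityI) (use in_V in \<open>auto simp: g_def marks_def d_def\<close>)
    finally show "holds w \<phi> (map \<sigma> xs) = L (map g (encw w (marks V \<sigma> \<tau>)))" .
  qed
qed

lemma rec_rel_ex_tuple:
  assumes "finite Z" "rec_rel (V \<union> Z) A"
  shows "rec_rel V (\<lambda>w \<sigma> \<tau>. \<exists>\<sigma>'. (\<forall>x\<in>Z. \<sigma>' x < length w) \<and> (\<forall>x. x \<notin> Z \<longrightarrow> \<sigma>' x = \<sigma> x) \<and> A w \<sigma>' \<tau>)"
  using assms
proof (induction Z arbitrary: V)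
  case empty
  have "(\<lambda>w \<sigma> \<tau>. \<exists>\<sigma>'. (\<forall>x. \<sigma>' x = \<sigma> x) \<and> A w \<sigma>' \<tau>) = A"
    by (intro ext) (metis ext)
  then show ?case using empty by simp
next
  case (insert z Z)
  have "rec_rel (insert z V) (\<lambda>w \<sigma> \<tau>. \<exists>\<sigma>'. (\<forall>x\<in>Z. \<sigma>' x < length w) \<and> (\<forall>x. x \<notin> Z \<longrightarrow> \<sigma>' x = \<sigma> x) \<and> A w \<sigma>' \<tau>)"
    using insert.prems by (intro insert.IH) simp
  note ex = rec_rel_ex_FO[OF this]
  have eq: "(\<exists>p<length w. \<exists>\<sigma>'. (\<forall>x\<in>Z. \<sigma>' x < length w) \<and> (\<forall>x. x \<notin> Z \<longrightarrow> \<sigma>' x = (\<sigma>(z := p)) x) \<and> A w \<sigma>' \<tau>)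
    \<longleftrightarrow> (\<exists>\<sigma>'. (\<forall>x\<in>insert z Z. \<sigma>' x < length w) \<and> (\<forall>x. x \<notin> insert z Z \<longrightarrow> \<sigma>' x = \<sigma> x) \<and> A w \<sigma>' \<tau>)"
    (is "?l \<longleftrightarrow> ?r") for w :: "nat list" and \<sigma> \<tau>
  proof
    assume ?l
    then obtain p \<sigma>' where "p < length w" "\<forall>x\<in>Z. \<sigma>' x < length w"
      "\<forall>x. x \<notin> Z \<longrightarrow> \<sigma>' x = (\<sigma>(z := p)) x" "A w \<sigma>' \<tau>" by blast
    then show ?r
      using insert.hyps by (intro exI[of _ \<sigma>']) auto
  next
    assume ?r
    then obtain \<sigma>' where "\<forall>x\<in>insert z Z. \<sigma>' x < length w"
      "\<forall>x. x \<notin> insert z Z \<longrightarrow> \<sigma>' x = \<sigma> x" "A w \<sigma>' \<tau>" by blast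
    then show ?l
      by (intro exI[of _ "\<sigma>' z"] conjI exI[of _ \<sigma>']) auto
  qed
  show ?case
    using ex unfolding eq .
qed

section \<open>Pumping\<close>

definition pumped :: "nat \<Rightarrow> nat \<Rightarrow> nat \<Rightarrow> 'a list \<Rightarrow> 'a list" where
  "pumped r p p' w = take p w @ concat (replicate r (take (p' - p) (drop p w))) @ drop p' w"

lemma length_concat_replicate [simp]: "length (concat (replicate r xs)) = r * length xs"
  by (induction r) auto

lemma concat_replicate_add:
  "concat (replicate (i + j) xs) = concat (replicate i xs) @ concat (replicate j xs)"
  by (induction i) auto

lemma encw_append: "encw (u @ v) S = encw u S @ encw v (\<lambda>i. S (length u + i))"
  by (rule nth_equalityI) (auto simp: nth_append)

lemma encw_cong: "(\<And>p. p < length w \<Longrightarrow> S p = S' p) \<Longrightarrow> encw w S = encw w S'"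
  by (simp add: encw_def)

lemma encw_empty: "encw w (\<lambda>_. {}) = map (\<lambda>a. (a, {})) w"
  by (rule nth_equalityI) auto

lemma pigeonhole_pair:
  fixes P :: "nat set"
  assumes "finite C" "g ` P \<subseteq> C" "card P > card C"
  obtains p p' where "p \<in> P" "p' \<in> P" "p < p'" "g p = g p'"
proof -
  have "\<not> inj_on g P"
    using assms card_inj_on_le[of g P C] by auto
  then obtain a b where "a \<in> P" "b \<in> P" "a \<noteq> b" "g a = g b"
    by (auto simp: inj_on_def)
  then show ?thesis
    using that by (metis linorder_neqE_nat)
qed

text \<open>Two positions p < p' are pumpable when the prefixes before them, the suffixes from them and the
  suffixes from them with an extra mark at the start have equal types: then every copy of the factor
  from p to p' looks, together with the next copy, like the original pair.\<close>

lemma pumping: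
  assumes A: "rec_rel {..<n + 2} (\<lambda>w \<sigma> \<tau>. A w (map \<sigma> [0..<n]) (\<sigma> n) (\<sigma> (Suc n)))"
  shows "\<exists>C. \<forall>w ps P. length ps = n \<longrightarrow> (\<forall>x\<in>set ps. x < length w) \<longrightarrow> P \<subseteq> {..<length w} \<longrightarrow> C < card P \<longrightarrow>
    (\<exists>p\<in>P. \<exists>p'\<in>P. p < p' \<and> (A w ps p p' \<longrightarrow> (\<forall>r\<ge>1. \<exists>ps'. length ps' = n \<and>
       (\<forall>i<r. A (pumped r p p' w) ps' (p + i * (p' - p)) (p + Suc i * (p' - p))))))"
proof -
  obtain L where L: "rec_lang L" and AL: "\<And>w \<sigma> \<tau>. (\<And>x. x \<in> {..<n + 2} \<Longrightarrow> \<sigma> x < length w) \<Longrightarrow>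
      A w (map \<sigma> [0..<n]) (\<sigma> n) (\<sigma> (Suc n)) = L (encw w (marks {..<n + 2} \<sigma> \<tau>))"
    using A unfolding rec_rel_def by blast
  obtain h :: "(nat \<times> (nat + nat) set) list \<Rightarrow> nat" where fin: "finite (range h)"
    and cong: "\<And>u u' v v'. h u = h u' \<Longrightarrow> h v = h v' \<Longrightarrow> h (u @ v) = h (u' @ v')"
    and hL: "\<And>u u'. h u = h u' \<Longrightarrow> L u = L u'"
    using L unfolding rec_lang_def by blast
  define mk :: "nat list \<Rightarrow> nat \<Rightarrow> (nat + nat) set"
    where "mk ps x = {Inl i |i. i < n \<and> ps ! i = x}" for ps x
  \<comment> \<open>Tracks \<open>n\<close> and \<open>Suc n\<close> carry the two distinguished
    positions, the lower tracks the entries of \<open>ps\<close>.\<close>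
  define mk2 :: "nat list \<Rightarrow> nat \<Rightarrow> nat \<Rightarrow> nat \<Rightarrow> (nat + nat) set"
    where "mk2 ps p p' x = mk ps x \<union> (if x = p then {Inl n} else {}) \<union> (if x = p' then {Inl (Suc n)} else {})"
      for ps p p' x
  have A_mk2: "A w ps p p' = L (encw w (mk2 ps p p'))"
    if "length ps = n" "\<forall>x\<in>set ps. x < length w" "p < length w" "p' < length w" for w ps p p'
  proof -
    let ?\<sigma> = "\<lambda>i. if i < n then ps ! i else if i = n then p else p'"
    have eq: "map ?\<sigma> [0..<n] = ps"
      by (rule nth_equalityI) (auto simp: that)
    have "A w (map ?\<sigma> [0..<n]) (?\<sigma> n) (?\<sigma> (Suc n)) = L (encw w (marks {..<n + 2} ?\<sigma> (\<lambda>_. {})))"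
    proof (rule AL)
      show "(if x < n then ps ! x else if x = n then p else p') < length w" for x
        using that by simp
    qed
    moreover have "marks {..<n + 2} ?\<sigma> (\<lambda>_. {}) = mk2 ps p p'"
    proof (intro ext set_eqI)
      fix x t
      show "t \<in> marks {..<n + 2} ?\<sigma> (\<lambda>_. {}) x \<longleftrightarrow> t \<in> mk2 ps p p' x"
        by (cases t) (auto simp: marks_def mk2_def mk_def less_Suc_eq split: if_splits)
    qed
    ultimately show ?thesis
      unfolding eq by simp
  qed
  define C where "C = card (Pow {..<n} \<times> range h \<times> range h \<times> range h)"
  show ?thesis
  proof (intro exI[of _ C] allI impI)
    fix w ps :: "nat list" and P :: "nat set"
    assume ps: "length ps = n" "\<forall>x\<in>set ps. x < length w"
      and P: "P \<subseteq> {..<length w}" "C < card P"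
    \<comment> \<open>Equal first components ensure that no entry of \<open>ps\<close> lies in the
      factor from p to p', so copies of the factor carry no marks from \<open>ps\<close>. The other
      components are the three types named above.\<close>
    define g where "g p = ({i. i < n \<and> ps ! i < p}, h (encw (take p w) (mk ps)),
      h (encw (drop p w) (\<lambda>x. mk ps (p + x))),
      h (encw (drop p w) (\<lambda>x. mk ps (p + x) \<union> (if x = 0 then {Inl (Suc n)} else {}))))" for p
    obtain p p' where pp: "p \<in> P" "p' \<in> P" "p < p'" "g p = g p'"
    proof (rule pigeonhole_pair)
      show "finite (Pow {..<n} \<times> range h \<times> range h \<times> range h)"
        using fin by simp
      show "g ` P \<subseteq> Pow {..<n} \<times> range h \<times> range h \<times> range h"
        by (auto simp: g_def)
    qed (use P(2) in \<open>simp_all add: C_def\<close>)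
    then have p'w: "p' < length w" using P(1) by auto
    have ps_w: "ps ! i < length w" if "i < n" for i
      using ps that by simp
    have sides: "ps ! i < p \<longleftrightarrow> ps ! i < p'" if "i < n" for i
    proof -
      have "i \<in> {i. i < n \<and> ps ! i < p} \<longleftrightarrow> i \<in> {i. i < n \<and> ps ! i < p'}"
        using pp(4) by (simp only: g_def prod.inject)
      then show ?thesis using that by simp
    qed
    define \<alpha> \<eta> \<delta> l where "\<alpha> = take p w" and "\<eta> = take (p' - p) (drop p w)" and "\<delta> = drop p' w" and "l = p' - p"
    have w: "w = \<alpha> @ \<eta> @ \<delta>"
      using pp(3) unfolding \<alpha>_def \<eta>_def \<delta>_def
      by (metis append_take_drop_id drop_drop le_add_diff_inverse2 less_imp_le_nat)
    have len: "length \<alpha> = p" "length \<eta> = l" "l > 0" "p' = p + l"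
      using pp(3) p'w by (auto simp: \<alpha>_def \<eta>_def l_def)
    have take_p': "take p' w = \<alpha> @ \<eta>" and drop_p: "drop p w = \<eta> @ \<delta>"
      unfolding w using len by simp_all
    have drop_p': "drop p' w = \<delta>" and take_p: "take p w = \<alpha>"
      by (simp_all add: \<delta>_def \<alpha>_def)
    have \<delta>0: "\<delta> \<noteq> []" using p'w by (simp add: \<delta>_def)
    define a where "a = encw \<alpha> (mk ps)"
    define e where "e = encw \<eta> (\<lambda>_. {})"
    define e1 where "e1 = encw \<eta> (\<lambda>x. if x = 0 then {Inl n} else {})"
    define e2 where "e2 = encw \<eta> (\<lambda>x. if x = 0 then {Inl (Suc n)} else {})"
    define d where "d = encw \<delta> (\<lambda>x. mk ps (p' + x))"
    define d2 where "d2 = encw \<delta> (\<lambda>x. mk ps (p' + x) \<union> (if x = 0 then {Inl (Suc n)} else {}))"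
    have mk_\<eta>: "mk ps (p + x) = {}" if "x < l" for x
      using sides that len unfolding mk_def by fastforce
    have pre: "encw (take p w) (mk ps) = a" "encw (take p' w) (mk ps) = a @ e"
      unfolding take_p take_p' encw_append a_def e_def
      by (auto simp: len mk_\<eta> intro!: encw_cong)
    have suf: "encw (drop p w) (\<lambda>x. mk ps (p + x)) = e @ d" "encw (drop p' w) (\<lambda>x. mk ps (p' + x)) = d"
      unfolding drop_p drop_p' encw_append d_def e_def
      by (auto simp: len mk_\<eta> add.assoc intro!: encw_cong)
    have suf2: "encw (drop p w) (\<lambda>x. mk ps (p + x) \<union> (if x = 0 then {Inl (Suc n)} else {})) = e2 @ d"
      "encw (drop p' w) (\<lambda>x. mk ps (p' + x) \<union> (if x = 0 then {Inl (Suc n)} else {})) = d2"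
      unfolding drop_p drop_p' encw_append d_def d2_def e2_def
      using \<open>l > 0\<close> by (auto simp: len(1,2,4) mk_\<eta> add.assoc intro!: encw_cong)
    have types: "h a = h (a @ e)" "h (e @ d) = h d" "h (e2 @ d) = h d2"
      using pp(4) unfolding g_def prod.inject pre suf suf2 by simp_all
    \<comment> \<open>Unmarked copies of the factor are absorbed by the prefix, and likewise by the
      suffix below.\<close>
    have pre_pow: "h (a @ concat (replicate i e)) = h a" for i
    proof (induction i)
      case (Suc i)
      have "h ((a @ e) @ concat (replicate i e)) = h (a @ concat (replicate i e))"
        by (rule cong) (simp_all add: types(1)[symmetric])
      then show ?case using Suc by simp
    qed simp
    have suf_pow: "h (concat (replicate i e) @ d) = h d" for i
    proof (induction i)
      case (Suc i)
      have "h (e @ concat (replicate i e) @ d) = h (e @ d)"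
        by (rule cong) (simp_all add: Suc)
      then show ?case using types(2) by simp
    qed simp
    have encw_pow: "encw (concat (replicate i \<eta>)) (\<lambda>_. {}) = concat (replicate i e)" for i
      unfolding e_def encw_empty by (simp add: map_concat map_replicate)
    have orig: "encw w (mk2 ps p p') = a @ e1 @ d2"
      unfolding w encw_append a_def e1_def d2_def using \<open>l > 0\<close>
      by (auto simp: len(1,2,4) mk2_def mk_\<eta> add.assoc intro!: encw_cong)
    have "A w ps p p' \<longrightarrow> (\<forall>r\<ge>1. \<exists>ps'. length ps' = n \<and>
       (\<forall>i<r. A (pumped r p p' w) ps' (p + i * (p' - p)) (p + Suc i * (p' - p))))"
    proof (intro impI allI)
      fix r :: nat
      assume "A w ps p p'" and r: "1 \<le> r"
      then have orig_L: "L (a @ e1 @ d2)"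
        using A_mk2[OF ps] p'w pp(3) orig by simp
      define v where "v = pumped r p p' w"
      \<comment> \<open>Entries beyond the factor move right by the \<open>r - 1\<close> additional
        copies.\<close>
      define ps' where "ps' = map (\<lambda>x. if x < p then x else x + (r - 1) * l) ps"
      have v: "v = \<alpha> @ concat (replicate r \<eta>) @ \<delta>"
        by (simp add: v_def pumped_def \<alpha>_def \<eta>_def \<delta>_def)
      have lv: "length v = length w + (r - 1) * l"
        unfolding v w using r len by (cases r) auto
      have lw: "length w = p + l + length \<delta>"
        using w len by simp
      have ps'_mem: "\<forall>x\<in>set ps'. x < length v"
        using ps(2) lv len lw by (auto simp: ps'_def)
      have ps'_nth: "ps' ! i = (if ps ! i < p then ps ! i else ps ! i + (r - 1) * l)" if "i < n" for i
        using that ps by (simp add: ps'_def)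
      have rl: "r * l = l + (r - 1) * l"
        using r by (cases r) auto
      have mk_low: "mk ps' x = mk ps x" if "x < p" for x
        using that ps'_nth unfolding mk_def by (auto split: if_splits)
      have mk_mid: "mk ps' (p + x) = {}" if "x < r * l" for x
        using that ps'_nth sides len rl unfolding mk_def by (fastforce split: if_splits)
      have mk_high: "mk ps' (p + (r * l + x)) = mk ps (p' + x)" for x
        using ps'_nth sides len rl unfolding mk_def
        by (auto split: if_splits)
      have "A v ps' (p + i * l) (p + Suc i * l)" if i: "i < r" for i
      proof -
        have il: "Suc i * l \<le> r * l"
          using i by (intro mult_le_mono1) simp
        define k where "k = r - Suc i"
        have r_eq: "r = i + Suc k"
          using i by (simp add: k_def)
        have kl: "r * l = i * l + (l + k * l)"
          unfolding r_eq by (simp add: algebra_simps)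
        have v': "v = \<alpha> @ concat (replicate i \<eta>) @ \<eta> @ concat (replicate k \<eta>) @ \<delta>"
          unfolding v r_eq concat_replicate_add by simp
        let ?S = "mk2 ps' (p + i * l) (p + Suc i * l)"
        have S1: "encw \<alpha> ?S = a"
          unfolding a_def using mk_low by (auto simp: len(1,2,4) mk2_def intro!: encw_cong)
        have S2: "encw (concat (replicate i \<eta>)) (\<lambda>x. ?S (p + x)) = concat (replicate i e)"
          unfolding encw_pow[symmetric] using mk_mid \<open>l > 0\<close> by (auto simp: kl len(1,2,4) mk2_def intro!: encw_cong)
        have S3: "encw \<eta> (\<lambda>x. ?S (p + (i * l + x))) = e1"
          unfolding e1_def using mk_mid \<open>l > 0\<close> by (auto simp: kl len(1,2,4) mk2_def intro!: encw_cong)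
        \<comment> \<open>The second mark stands on the first letter after copy i. This is the start
          of \<open>\<delta>\<close> if copy i is the last one and the start of the next copy
          otherwise; the types of \<open>d2\<close> and \<open>e2 @ d\<close> agree, so both cases
          look like the original suffix.\<close>
        have S4: "h (encw (concat (replicate k \<eta>) @ \<delta>) (\<lambda>x. ?S (p + (i * l + (l + x))))) = h d2"
        proof (cases k)
          case 0
          have "encw \<delta> (\<lambda>x. ?S (p + (i * l + (l + x)))) = d2"
            unfolding d2_def using mk_high 0 \<open>l > 0\<close> by (auto simp: kl len(1,2,4) mk2_def add.assoc intro!: encw_cong)
          then show ?thesis using 0 by simp
        next
          case (Suc k')
          have "encw \<eta> (\<lambda>x. ?S (p + (i * l + (l + x)))) = e2"
            unfolding e2_def using mk_mid Suc \<open>l > 0\<close>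
            by (auto simp: kl len(1,2,4) mk2_def add.assoc intro!: encw_cong)
          moreover have "encw (concat (replicate k' \<eta>)) (\<lambda>x. ?S (p + (i * l + (l + (l + x))))) = concat (replicate k' e)"
            unfolding encw_pow[symmetric] using mk_mid Suc \<open>l > 0\<close>
            by (auto simp: kl len(1,2,4) mk2_def add.assoc intro!: encw_cong)
          moreover have "encw \<delta> (\<lambda>x. ?S (p + (i * l + (l + (l + (k' * l + x)))))) = d"
            unfolding d_def using mk_high Suc \<open>l > 0\<close> by (auto simp: kl len(1,2,4) mk2_def add.assoc intro!: encw_cong)
          ultimately have "encw (concat (replicate k \<eta>) @ \<delta>) (\<lambda>x. ?S (p + (i * l + (l + x)))) = e2 @ concat (replicate k' e) @ d"
            unfolding Suc by (simp add: encw_append len)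
          moreover have "h (e2 @ concat (replicate k' e) @ d) = h (e2 @ d)"
            by (rule cong[OF refl suf_pow])
          ultimately show ?thesis using types(3) by simp
        qed
        have "h (encw v ?S) = h ((a @ concat (replicate i e)) @ e1 @ encw (concat (replicate k \<eta>) @ \<delta>) (\<lambda>x. ?S (p + (i * l + (l + x)))))"
          unfolding v' using S1 S2 S3 by (simp add: encw_append len add.assoc)
        also have "\<dots> = h (a @ e1 @ d2)"
          by (intro cong pre_pow refl S4)
        finally have "L (encw v ?S)"
          using orig_L hL by metis
        moreover have "0 < length \<delta>" "i * l \<le> Suc i * l"
          using \<delta>0 by simp_all
        then have "p + i * l < length v" "p + Suc i * l < length v"
          using il lv lw rl by linarith+
        ultimately show ?thesis
          using A_mk2[of ps' v] ps ps'_mem by (simp add: ps'_def)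
      qed
      then show "\<exists>ps'. length ps' = n \<and>
         (\<forall>i<r. A (pumped r p p' w) ps' (p + i * (p' - p)) (p + Suc i * (p' - p)))"
        using ps by (intro exI[of _ ps']) (auto simp: v_def l_def ps'_def)
    qed
    then show "\<exists>p\<in>P. \<exists>p'\<in>P. p < p' \<and> (A w ps p p' \<longrightarrow> (\<forall>r\<ge>1. \<exists>ps'. length ps' = n \<and>
       (\<forall>i<r. A (pumped r p p' w) ps' (p + i * (p' - p)) (p + Suc i * (p' - p)))))"
      using pp(1-3) by blast
  qed
qed

section \<open>The interleaved lexicographic order on pairs of positions\<close>

text \<open>A letter at most j ends a level-j block, so \<open>blk w j x\<close> is the index of the level-j block of x.
  Pairs are compared by the level-0 blocks of their components, then by the level-1 blocks, and so
  on; the label shows at which levels a pair is the last one of its cell.\<close>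

definition blk :: "nat list \<Rightarrow> nat \<Rightarrow> nat \<Rightarrow> nat" where
  "blk w j x = card {z. z < x \<and> w ! z \<le> j}"

fun key :: "nat list \<Rightarrow> nat list \<Rightarrow> nat \<times> nat \<Rightarrow> nat list" where
  "key w [] c = []"
| "key w (j # js) c = blk w j (fst c) # blk w j (snd c) # key w js c"

definition pairs :: "nat \<Rightarrow> nat list \<Rightarrow> (nat \<times> nat) list" where
  "pairs m w = sort_key (key w [0..<Suc m]) (List.product [0..<length w] [0..<length w])"

definition pair_label :: "nat list \<Rightarrow> nat \<times> nat \<Rightarrow> nat" where
  "pair_label w c = max (w ! fst c) (w ! snd c)"

definition interleave :: "nat \<Rightarrow> nat list \<Rightarrow> nat list" where
  "interleave m w = map (pair_label w) (pairs m w)"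

section \<open>Block indices and keys\<close>

lemma blk_0 [simp]: "blk w j 0 = 0"
  by (simp add: blk_def)

lemma blk_Suc: "blk w j (Suc x) = blk w j x + (if w ! x \<le> j then 1 else 0)"
proof -
  have "{z. z < Suc x \<and> w ! z \<le> j} = (if w ! x \<le> j then insert x {z. z < x \<and> w ! z \<le> j} else {z. z < x \<and> w ! z \<le> j})"
    by (auto simp: less_Suc_eq)
  then show ?thesis by (simp add: blk_def)
qed

lemma blk_mono: "x \<le> y \<Longrightarrow> blk w j x \<le> blk w j y"
  unfolding blk_def by (rule card_mono) auto

lemma blk_less_iff: "blk w j x < blk w j y \<longleftrightarrow> (\<exists>z. x \<le> z \<and> z < y \<and> w ! z \<le> j)"
proof (induction y)
  case (Suc y)
  show ?case
  proof (cases "x \<le> y")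
    case True
    then have "blk w j x \<le> blk w j y" by (rule blk_mono)
    then show ?thesis using Suc True by (auto simp: blk_Suc less_Suc_eq)
  next
    case False
    then have "blk w j (Suc y) \<le> blk w j x" by (intro blk_mono) simp
    then show ?thesis using False by auto
  qed
qed auto

text \<open>Every end of a level-i block is also an end of a level-j block, so positions not
  separated at level j are not separated at level i.\<close>

lemma blk_eq_coarser:
  assumes "blk w j x = blk w j y" "i \<le> j"
  shows "blk w i x = blk w i y"
  using assms blk_less_iff[of w j x y] blk_less_iff[of w j y x]
    blk_less_iff[of w i x y] blk_less_iff[of w i y x] by (metis le_trans linorder_neqE_nat less_irrefl)

lemma letter_le: "w \<in> lists {..m} \<Longrightarrow> x < length w \<Longrightarrow> w ! x \<le> m"
  using nth_mem by fastforce

lemma blk_finest: "w \<in> lists {..m} \<Longrightarrow> x \<le> length w \<Longrightarrow> blk w m x = x"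
  by (induction x) (simp_all add: blk_Suc letter_le)

lemma key_append: "key w (is @ js) c = key w is c @ key w js c"
  by (induction "is") auto

lemma length_key [simp]: "length (key w js c) = 2 * length js"
  by (induction js) auto

lemma key_eq_iff:
  "key w js c = key w js d \<longleftrightarrow> (\<forall>j\<in>set js. blk w j (fst c) = blk w j (fst d) \<and> blk w j (snd c) = blk w j (snd d))"
  by (induction js) auto

text \<open>Agreement at level j forces agreement at all coarser levels, so this initial part of the
  key is a name for the level-j cell.\<close>

lemma key_cell_iff:
  "key w [0..<Suc j] c = key w [0..<Suc j] d \<longleftrightarrow> blk w j (fst c) = blk w j (fst d) \<and> blk w j (snd c) = blk w j (snd d)"
proof
  assume r: "blk w j (fst c) = blk w j (fst d) \<and> blk w j (snd c) = blk w j (snd d)"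
  show "key w [0..<Suc j] c = key w [0..<Suc j] d"
    unfolding key_eq_iff
  proof
    fix i assume "i \<in> set [0..<Suc j]"
    then have "i \<le> j" by auto
    then show "blk w i (fst c) = blk w i (fst d) \<and> blk w i (snd c) = blk w i (snd d)"
      using r blk_eq_coarser by metis
  qed
qed (simp add: key_eq_iff del: upt_Suc)

lemma key_mono: "fst c \<le> fst d \<Longrightarrow> snd c \<le> snd d \<Longrightarrow> key w js c \<le> key w js d"
proof (induction js)
  case (Cons j js)
  then have "blk w j (fst c) \<le> blk w j (fst d)" "blk w j (snd c) \<le> blk w j (snd d)"
    by (auto intro: blk_mono)
  with Cons show ?case by auto
qed simp

lemma append_le_append_iff:
  fixes xs ys us vs :: "nat list"
  assumes "length xs = length ys"
  shows "xs @ us \<le> ys @ vs \<longleftrightarrow> xs < ys \<or> xs = ys \<and> us \<le> vs"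
  using assms by (induction rule: list_induct2) auto

lemma key_split:
  assumes "j \<le> m"
  shows "key w [0..<Suc m] c = key w [0..<Suc j] c @ key w [Suc j..<Suc m] c"
proof -
  have "[0..<Suc m] = [0..<Suc j] @ [Suc j..<Suc m]"
    using upt_add_eq_append[of 0 "Suc j" "m - j"] assms by (simp del: upt_Suc)
  then show ?thesis by (simp only: key_append)
qed

lemma key_coarser_le:
  assumes "j \<le> m" "key w [0..<Suc m] c \<le> key w [0..<Suc m] d"
  shows "key w [0..<Suc j] c \<le> key w [0..<Suc j] d"
proof -
  have "length (key w [0..<Suc j] c) = length (key w [0..<Suc j] d)" by simp
  from append_le_append_iff[OF this] show ?thesis
    using assms by (auto simp: key_split simp del: upt_Suc)
qed

text \<open>All letters are at most m, so level-m blocks are single positions and the last two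
  entries of the key are the pair itself.\<close>

lemma key_inj:
  assumes "w \<in> lists {..m}" "fst c < length w" "snd c < length w" "fst d < length w" "snd d < length w"
    and "key w [0..<Suc m] c = key w [0..<Suc m] d"
  shows "c = d"
  using assms(6)[unfolded key_cell_iff] assms(1-5) blk_finest[OF assms(1)]
  by (auto simp: prod_eq_iff)

section \<open>The sorted list of pairs and its cells\<close>

lemma set_pairs [simp]: "set (pairs m w) = {..<length w} \<times> {..<length w}"
  by (auto simp: pairs_def)

lemma distinct_pairs [simp]: "distinct (pairs m w)"
  by (simp add: pairs_def distinct_product)

lemma length_pairs [simp]: "length (pairs m w) = length w * length w"
  by (simp add: pairs_def)

lemma length_interleave [simp]: "length (interleave m w) = length w * length w"
  by (simp add: interleave_def)

lemma pairs_nth_less: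
  assumes "i < length w * length w"
  shows "fst (pairs m w ! i) < length w" "snd (pairs m w ! i) < length w"
proof -
  have "pairs m w ! i \<in> set (pairs m w)"
    using assms by (intro nth_mem) simp
  then show "fst (pairs m w ! i) < length w" "snd (pairs m w ! i) < length w"
    by auto
qed

lemma pairs_index:
  assumes "fst c < length w" "snd c < length w"
  obtains i where "i < length w * length w" "pairs m w ! i = c"
proof -
  have "c \<in> set (pairs m w)"
    using assms by (cases c) auto
  then show ?thesis
    using that by (auto simp: in_set_conv_nth simp del: set_pairs)
qed

lemma pairs_le_iff:
  assumes w: "w \<in> lists {..m}" and ij: "i < length w * length w" "j < length w * length w"
  shows "i \<le> j \<longleftrightarrow> key w [0..<Suc m] (pairs m w ! i) \<le> key w [0..<Suc m] (pairs m w ! j)"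
proof
  have "sorted (map (key w [0..<Suc m]) (pairs m w))"
    unfolding pairs_def by (rule sorted_sort_key)
  then have mono: "key w [0..<Suc m] (pairs m w ! a) \<le> key w [0..<Suc m] (pairs m w ! b)"
    if "a \<le> b" "b < length w * length w" for a b
    using that sorted_nth_mono[of "map (key w [0..<Suc m]) (pairs m w)" a b] by simp
  then show "key w [0..<Suc m] (pairs m w ! i) \<le> key w [0..<Suc m] (pairs m w ! j)" if "i \<le> j"
    using that ij by blast
  assume le: "key w [0..<Suc m] (pairs m w ! i) \<le> key w [0..<Suc m] (pairs m w ! j)"
  show "i \<le> j"
  proof (rule ccontr)
    assume "\<not> i \<le> j"
    then have "key w [0..<Suc m] (pairs m w ! j) \<le> key w [0..<Suc m] (pairs m w ! i)"
      using mono ij by simp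
    then have "pairs m w ! i = pairs m w ! j"
      using le pairs_nth_less[OF ij(1)] pairs_nth_less[OF ij(2)] by (intro key_inj[OF w]) auto
    then have "i = j"
      using ij nth_eq_iff_index_eq[OF distinct_pairs] by simp
    then show False using \<open>\<not> i \<le> j\<close> by simp
  qed
qed

text \<open>Cells are assigned to output positions rather than to pairs, because output positions
  are also what the configurations of a transducer can be matched with.\<close>

definition cell :: "nat \<Rightarrow> nat list \<Rightarrow> nat \<Rightarrow> nat \<Rightarrow> nat \<times> nat" where
  "cell m w j i = (blk w j (fst (pairs m w ! i)), blk w j (snd (pairs m w ! i)))"

lemma cell_eq_iff:
  "cell m w j i = cell m w j i' \<longleftrightarrow> key w [0..<Suc j] (pairs m w ! i) = key w [0..<Suc j] (pairs m w ! i')"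
  unfolding key_cell_iff cell_def by simp

text \<open>Cutting keys off after level j preserves their order, so the key prefix of i is squeezed
  between two equal ones.\<close>

lemma cell_contiguous:
  assumes "w \<in> lists {..m}" "j \<le> m" "cell m w j a = cell m w j b"
    and "a \<le> i" "i \<le> b" "b < length w * length w"
  shows "cell m w j i = cell m w j a"
proof -
  let ?k = "\<lambda>j i. key w [0..<Suc j] (pairs m w ! i)"
  have "?k m a \<le> ?k m i" "?k m i \<le> ?k m b"
    using assms pairs_le_iff[OF assms(1), of a i] pairs_le_iff[OF assms(1), of i b]
    by (simp_all del: upt_Suc)
  then have "?k j a \<le> ?k j i" "?k j i \<le> ?k j b"
    using key_coarser_le[OF assms(2)] by blast+
  then show ?thesis
    using assms(3) unfolding cell_eq_iff by simp
qed

text \<open>The final letter 0 ends a block of every level, so a block end exists at or after x; y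
  is the first one.\<close>

lemma block_last:
  assumes "last w = 0" "x < length w"
  obtains y where "x \<le> y" "y < length w" "w ! y \<le> j" "blk w j y = blk w j x"
proof -
  have "x \<le> length w - 1 \<and> w ! (length w - 1) \<le> j"
  proof -
    have "w \<noteq> []" using assms(2) by auto
    then show ?thesis using assms by (simp add: last_conv_nth)
  qed
  then have ex: "\<exists>z. x \<le> z \<and> w ! z \<le> j" by blast
  define y where "y = (LEAST z. x \<le> z \<and> w ! z \<le> j)"
  have y: "x \<le> y" "w ! y \<le> j"
    using LeastI_ex[OF ex] unfolding y_def by blast+
  have least: "\<not> (x \<le> z \<and> w ! z \<le> j)" if "z < y" for z
    using that unfolding y_def by (rule not_less_Least)
  have "y \<le> length w - 1"
    unfolding y_def by (rule Least_le) (rule \<open>x \<le> length w - 1 \<and> w ! (length w - 1) \<le> j\<close>)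
  moreover have "\<not> blk w j x < blk w j y"
    using least by (auto simp: blk_less_iff)
  ultimately show ?thesis
    using that[of y] y assms(2) blk_mono[OF y(1), of w j] by simp
qed

text \<open>The last pair of a cell consists of the last positions of its two blocks.\<close>

lemma label_between_cells:
  assumes w: "w \<in> lists {..m}" "last w = 0" and j: "j \<le> m"
    and ab: "a \<le> b" "b < length w * length w" "cell m w j a \<noteq> cell m w j b"
  obtains i where "a \<le> i" "i < b" "interleave m w ! i \<le> j"
proof -
  let ?k = "\<lambda>j c. key w [0..<Suc j] c"
  let ?a = "pairs m w ! a" and ?b = "pairs m w ! b"
  have a: "fst ?a < length w" "snd ?a < length w"
    using ab by (auto intro!: pairs_nth_less)
  obtain x where x: "fst ?a \<le> x" "x < length w" "w ! x \<le> j" "blk w j x = blk w j (fst ?a)"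
    using block_last[OF w(2) a(1)] by metis
  obtain y where y: "snd ?a \<le> y" "y < length w" "w ! y \<le> j" "blk w j y = blk w j (snd ?a)"
    using block_last[OF w(2) a(2)] by metis
  obtain i where i: "i < length w * length w" "pairs m w ! i = (x, y)"
    using x y by (metis fst_conv pairs_index snd_conv)
  have "?k m ?a \<le> ?k m (pairs m w ! i)"
    unfolding i(2) by (rule key_mono) (simp_all add: x(1) y(1))
  then have "a \<le> i"
    using pairs_le_iff[OF w(1), of a i] ab i(1) by simp
  have "cell m w j i = cell m w j a"
    using x y i by (simp add: cell_def)
  have "i < b"
  proof (rule ccontr)
    assume "\<not> i < b"
    then have "cell m w j b = cell m w j a"
      using cell_contiguous[OF w(1) j, of a i b] \<open>cell m w j i = cell m w j a\<close> ab(1) i(1) by simp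
    then show False using ab(3) by simp
  qed
  moreover have "interleave m w ! i \<le> j"
    using i x y by (simp add: interleave_def pair_label_def)
  ultimately show ?thesis
    using that \<open>a \<le> i\<close> by blast
qed

text \<open>A label at most j means that both components end their level-j blocks. Such a pair is
  componentwise maximal in its cell, hence last in it because keys are monotone in both components,
  so no b of the same cell can follow.\<close>

lemma no_label_in_cell:
  assumes w: "w \<in> lists {..m}" and j: "j \<le> m"
    and ab: "a \<le> i" "i < b" "b < length w * length w" "cell m w j a = cell m w j b"
  shows "\<not> interleave m w ! i \<le> j"
proof
  assume "interleave m w ! i \<le> j"
  moreover have i: "i < length w * length w"
    using ab by simp
  ultimately have lab: "w ! fst (pairs m w ! i) \<le> j" "w ! snd (pairs m w ! i) \<le> j"
    by (simp_all add: interleave_def pair_label_def)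
  have "cell m w j i = cell m w j b"
    using cell_contiguous[OF w j ab(4) ab(1) less_imp_le[OF ab(2)] ab(3)] ab(4) by simp
  then have "fst (pairs m w ! b) \<le> fst (pairs m w ! i)" "snd (pairs m w ! b) \<le> snd (pairs m w ! i)"
    using lab blk_less_iff[of w j] unfolding cell_def prod.inject
    by (metis leI le_refl less_irrefl)+
  then have "b \<le> i"
    using pairs_le_iff[OF w ab(3) i] by (simp add: key_mono del: upt_Suc)
  then show False using ab(2) by simp
qed

lemma card_cell_le:
  assumes "\<And>b. card {x. x < length w \<and> blk w j x = b} \<le> B"
  shows "card {i. i < length w * length w \<and> cell m w j i = c} \<le> B * B"
proof -
  let ?X = "\<lambda>b. {x. x < length w \<and> blk w j x = b}"
  have "card {i. i < length w * length w \<and> cell m w j i = c} \<le> card (?X (fst c) \<times> ?X (snd c))"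
  proof (rule card_inj_on_le[of "(!) (pairs m w)"])
    show "inj_on ((!) (pairs m w)) {i. i < length w * length w \<and> cell m w j i = c}"
      by (rule inj_onI) (auto simp: nth_eq_iff_index_eq[OF distinct_pairs])
    show "(!) (pairs m w) ` {i. i < length w * length w \<and> cell m w j i = c} \<subseteq> ?X (fst c) \<times> ?X (snd c)"
      by (rule image_subsetI) (auto simp: cell_def mem_Times_iff pairs_nth_less)
  qed simp
  also have "\<dots> \<le> B * B"
    unfolding card_cartesian_product by (intro mult_le_mono assms)
  finally show ?thesis .
qed

section \<open>The function is polyregular with quadratic growth\<close>

definition Disj :: "mso \<Rightarrow> mso \<Rightarrow> mso" where
  "Disj \<phi> \<psi> = Neg (Conj (Neg \<phi>) (Neg \<psi>))"

fun label_le :: "nat \<Rightarrow> nat \<Rightarrow> mso" where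
  "label_le 0 x = Lab 0 x"
| "label_le (Suc j) x = Disj (label_le j x) (Lab (Suc j) x)"

text \<open>Comparing block indices needs no counting: the index grows between x and y iff some
  block ends in between. Variables 0, 1 and 2, 3 are reserved for the two pairs of an order formula,
  so the bound variable is 4.\<close>

definition blk_less :: "nat \<Rightarrow> nat \<Rightarrow> nat \<Rightarrow> mso" where
  "blk_less j x y = ExFO 4 (Conj (Conj (Le x 4) (Neg (Le y 4))) (label_le j 4))"

fun key_le :: "nat list \<Rightarrow> mso" where
  \<comment> \<open>\<open>Le 0 0\<close> plays the role of truth: equal keys satisfy the non-strict
    comparison.\<close>
  "key_le [] = Le 0 0"
| "key_le (j # js) = Disj (blk_less j 0 2) (Conj (Neg (blk_less j 2 0))
     (Disj (blk_less j 1 3) (Conj (Neg (blk_less j 3 1)) (key_le js))))"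

definition pair_label_eq :: "nat \<Rightarrow> mso" where
  "pair_label_eq b = Disj (Conj (Lab b 0) (label_le b 1)) (Conj (Lab b 1) (label_le b 0))"

definition interleave_interp :: "nat \<Rightarrow> interp" where
  "interleave_interp m = \<lparr>comps = {0}, dim = \<lambda>_. 2, univ = \<lambda>_. Le 0 0,
     ordf = \<lambda>_ _. key_le [0..<Suc m], labf = \<lambda>b _. pair_label_eq b\<rparr>"

lemma sat_Disj [simp]: "sat w \<sigma> \<tau> (Disj \<phi> \<psi>) \<longleftrightarrow> sat w \<sigma> \<tau> \<phi> \<or> sat w \<sigma> \<tau> \<psi>"
  by (simp add: Disj_def)

lemma fv_Disj [simp]: "fvFO (Disj \<phi> \<psi>) = fvFO \<phi> \<union> fvFO \<psi>" "fvSO (Disj \<phi> \<psi>) = fvSO \<phi> \<union> fvSO \<psi>"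
  by (simp_all add: Disj_def)

lemma sat_label_le [simp]: "sat w \<sigma> \<tau> (label_le j x) \<longleftrightarrow> w ! \<sigma> x \<le> j"
  by (induction j) auto

lemma fv_label_le [simp]: "fvFO (label_le j x) = {x}" "fvSO (label_le j x) = {}"
  by (induction j) auto

lemma sat_blk_less:
  assumes "x \<noteq> 4" "y \<noteq> 4" "\<sigma> y < length w"
  shows "sat w \<sigma> \<tau> (blk_less j x y) \<longleftrightarrow> blk w j (\<sigma> x) < blk w j (\<sigma> y)"
  using assms by (auto simp: blk_less_def blk_less_iff not_le intro: less_trans)

lemma fv_blk_less: "fvFO (blk_less j x y) \<subseteq> {x, y}" "fvSO (blk_less j x y) = {}"
  by (auto simp: blk_less_def)

lemma sat_key_le:
  assumes "\<forall>i<4. \<sigma> i < length w"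
  shows "sat w \<sigma> \<tau> (key_le js) \<longleftrightarrow> key w js (\<sigma> 0, \<sigma> 1) \<le> key w js (\<sigma> 2, \<sigma> 3)"
  using assms by (induction js) (auto simp: sat_blk_less)

lemma fv_key_le: "fvFO (key_le js) \<subseteq> {..<4} \<and> fvSO (key_le js) = {}"
proof (induction js)
  case (Cons j js)
  have "fvFO (blk_less j 0 2) \<subseteq> {..<4}" "fvFO (blk_less j 2 0) \<subseteq> {..<4}"
    "fvFO (blk_less j 1 3) \<subseteq> {..<4}" "fvFO (blk_less j 3 1) \<subseteq> {..<4}"
    by (rule order_trans[OF fv_blk_less(1)]; simp)+
  then show ?case using Cons by (simp add: fv_blk_less(2))
qed simp

lemma interleave_in_lists:
  assumes "w \<in> lists {..m}"
  shows "interleave m w \<in> lists {..m}"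
  using letter_le[OF assms] by (auto simp: interleave_def pair_label_def lists_eq_set)

lemma wf_interleave_interp: "wf_interp \<Gamma> (interleave_interp m)"
  using fv_key_le[of "[0..<Suc m]"]
  by (auto simp: wf_interp_def interleave_interp_def closed_in_def pair_label_eq_def simp del: upt_Suc)

lemma out_univ_interleave:
  "out_univ (interleave_interp m) w = (\<lambda>c. (0, [fst c, snd c])) ` ({..<length w} \<times> {..<length w})"
proof (intro equalityI subsetI)
  fix c assume "c \<in> out_univ (interleave_interp m) w"
  then obtain xs where "c = (0, xs)" "length xs = 2" "\<forall>x\<in>set xs. x < length w"
    by (auto simp: out_univ_def interleave_interp_def)
  then show "c \<in> (\<lambda>c. (0, [fst c, snd c])) ` ({..<length w} \<times> {..<length w})"
    by (auto simp: numeral_2_eq_2 length_Suc_conv intro: image_eqI[of _ _ "(x, y)" for x y])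
qed (auto simp: out_univ_def interleave_interp_def holds_def)

lemma polyregular_interleave: "polyregular {..m} {..m} (interleave m)"
  unfolding polyregular_def computes_def
proof (intro exI[of _ "interleave_interp m"] conjI wf_interleave_interp ballI)
  fix w assume w: "w \<in> lists {..m}"
  then show "interleave m w \<in> lists {..m}"
    by (rule interleave_in_lists)
  let ?n = "length (interleave m w)"
  define e :: "nat \<Rightarrow> nat \<times> nat list" where "e i = (0, [fst (pairs m w ! i), snd (pairs m w ! i)])" for i
  have bij: "bij_betw e {..<?n} (out_univ (interleave_interp m) w)"
  proof -
    have "bij_betw ((!) (pairs m w)) {..<?n} ({..<length w} \<times> {..<length w})"
      using bij_betw_nth[OF distinct_pairs refl refl, of m w] by simp
    moreover have "bij_betw (\<lambda>c. (0::nat, [fst c, snd c])) ({..<length w} \<times> {..<length w}) (out_univ (interleave_interp m) w)"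
      unfolding out_univ_interleave by (rule bij_betw_imageI) (auto simp: inj_on_def)
    ultimately have "bij_betw ((\<lambda>c. (0::nat, [fst c, snd c])) \<circ> (!) (pairs m w)) {..<?n} (out_univ (interleave_interp m) w)"
      by (rule bij_betw_trans)
    then show ?thesis
      by (simp add: e_def[abs_def] comp_def)
  qed
  have ord: "i \<le> j \<longleftrightarrow> out_le (interleave_interp m) w (e i) (e j)" if "i < ?n" "j < ?n" for i j
  proof -
    have "out_le (interleave_interp m) w (e i) (e j)
      \<longleftrightarrow> key w [0..<Suc m] (pairs m w ! i) \<le> key w [0..<Suc m] (pairs m w ! j)"
      using that pairs_nth_less[of _ w m]
      unfolding out_le_def interleave_interp_def holds_def
      by (subst interp.simps, subst sat_key_le)
        (auto simp: e_def less_Suc_eq numeral_eq_Suc simp del: upt_Suc)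
    then show ?thesis
      using pairs_le_iff[OF w, of i j] that by simp
  qed
  have lab: "out_lab (interleave_interp m) w b (e i) \<longleftrightarrow> b = interleave m w ! i" if "i < ?n" for i b
    using that by (auto simp: out_lab_def interleave_interp_def holds_def pair_label_eq_def e_def
        interleave_def pair_label_def max_def)
  show "\<exists>e. bij_betw e {..<?n} (out_univ (interleave_interp m) w)
      \<and> (\<forall>i<?n. \<forall>j<?n. (i \<le> j) = out_le (interleave_interp m) w (e i) (e j))
      \<and> (\<forall>i<?n. \<forall>b\<in>{..m}. out_lab (interleave_interp m) w b (e i) = (b = interleave m w ! i))"
    using bij ord lab by blast
qed

lemma growth_interleave: "growth {..m} (interleave m) n = n * n"
  unfolding growth_def
proof (rule Max_eqI)
  have "{w \<in> lists {..m}. length w \<le> n} = {w. set w \<subseteq> {..m} \<and> length w \<le> n}"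
    by auto
  then show "finite ((\<lambda>w. length (interleave m w)) ` {w \<in> lists {..m}. length w \<le> n})"
    by (simp add: finite_lists_length_le)
  show "n * n \<in> (\<lambda>w. length (interleave m w)) ` {w \<in> lists {..m}. length w \<le> n}"
    by (rule image_eqI[of _ _ "replicate n 0"]) auto
qed (auto intro: mult_le_mono)

section \<open>Configurations in one cell\<close>

text \<open>No label at most j is output from the earlier of c and d on and before the later one. The
  formulation is symmetric, so the output order of c and d never has to be known.\<close>

definition connected_confs :: "interp \<Rightarrow> nat \<Rightarrow> nat list \<Rightarrow> nat \<times> nat list \<Rightarrow> nat \<times> nat list \<Rightarrow> bool" where
  "connected_confs I j w c d \<longleftrightarrow> c \<in> out_univ I w \<and> d \<in> out_univ I w
     \<and> \<not> (\<exists>z\<in>out_univ I w. (\<exists>b\<in>{..j}. out_lab I w b z)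
          \<and> (out_le I w c z \<and> \<not> out_le I w d z \<or> out_le I w d z \<and> \<not> out_le I w c z))"

text \<open>The quantified tuple is stored in the block of variables \<open>N\<close>, ...,
  \<open>N + d - 1\<close>. The second assumption says that \<open>R\<close> does not read this
  block through the assignment, so overwriting it is harmless.\<close>

lemma rec_rel_ex_list:
  fixes R :: "nat list \<Rightarrow> (nat \<Rightarrow> nat) \<Rightarrow> nat list \<Rightarrow> bool"
  assumes "rec_rel (V \<union> {N..<N + d}) (\<lambda>w \<sigma> \<tau>. R w \<sigma> (map \<sigma> [N..<N + d]))"
    and R: "\<And>w \<sigma> \<sigma>' zs. (\<And>x. x \<notin> {N..<N + d} \<Longrightarrow> \<sigma>' x = \<sigma> x) \<Longrightarrow> R w \<sigma>' zs = R w \<sigma> zs"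
  shows "rec_rel V (\<lambda>w \<sigma> \<tau>. \<exists>zs. length zs = d \<and> (\<forall>x\<in>set zs. x < length w) \<and> R w \<sigma> zs)"
proof -
  have eq: "(\<exists>\<sigma>'. (\<forall>x\<in>{N..<N + d}. \<sigma>' x < length w) \<and> (\<forall>x. x \<notin> {N..<N + d} \<longrightarrow> \<sigma>' x = \<sigma> x) \<and> R w \<sigma>' (map \<sigma>' [N..<N + d]))
    \<longleftrightarrow> (\<exists>zs. length zs = d \<and> (\<forall>x\<in>set zs. x < length w) \<and> R w \<sigma> zs)" (is "?l \<longleftrightarrow> ?r") for w :: "nat list" and \<sigma>
  proof
    assume ?l
    then obtain \<sigma>' where \<sigma>': "\<forall>x\<in>{N..<N + d}. \<sigma>' x < length w" "\<And>x. x \<notin> {N..<N + d} \<Longrightarrow> \<sigma>' x = \<sigma> x"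
      "R w \<sigma>' (map \<sigma>' [N..<N + d])" by blast
    then have "R w \<sigma> (map \<sigma>' [N..<N + d])"
      using R[of \<sigma>' \<sigma> w] by blast
    then show ?r
      using \<sigma>'(1) by (intro exI[of _ "map \<sigma>' [N..<N + d]"]) auto
  next
    assume ?r
    then obtain zs where zs: "length zs = d" "\<forall>x\<in>set zs. x < length w" "R w \<sigma> zs" by blast
    define \<sigma>' where "\<sigma>' x = (if x \<in> {N..<N + d} then zs ! (x - N) else \<sigma> x)" for x
    have "map \<sigma>' [N..<N + d] = zs"
      by (rule nth_equalityI) (auto simp: \<sigma>'_def zs)
    moreover have off: "\<And>x. x \<notin> {N..<N + d} \<Longrightarrow> \<sigma>' x = \<sigma> x"
      unfolding \<sigma>'_def by (rule if_not_P)
    ultimately have "R w \<sigma>' (map \<sigma>' [N..<N + d])"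
      using zs(3) R[of \<sigma>' \<sigma> w, OF off] by simp
    moreover have "\<forall>x\<in>{N..<N + d}. \<sigma>' x < length w"
      using zs(1,2) by (auto simp: \<sigma>'_def)
    ultimately show ?l
      using off by blast
  qed
  show ?thesis
    using rec_rel_ex_tuple[OF _ assms(1)] unfolding eq by simp
qed

lemma bex_out_univ:
  "(\<exists>z\<in>out_univ I w. \<Phi> z) \<longleftrightarrow> (\<exists>q\<in>comps I. \<exists>xs. length xs = dim I q
     \<and> (\<forall>x\<in>set xs. x < length w) \<and> holds w (univ I q) xs \<and> \<Phi> (q, xs))"
  unfolding out_univ_def by blast

text \<open>For two configurations of one component that differ at most in the head, connectedness
  is a relation between \<open>n + 2\<close> positions: variables below \<open>n\<close> hold the
  common part of the stack, \<open>n\<close> and \<open>Suc n\<close> the two heads. The separating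
  configuration is searched for in each component, with its stack in the variables from
  \<open>n + 2\<close> on.\<close>

lemma rec_rel_connected_confs:
  assumes wf: "wf_interp {..m} I" and j: "j \<le> m" and q: "q \<in> comps I" "dim I q = Suc n"
  shows "rec_rel {..<n + 2} (\<lambda>w \<sigma> \<tau>. connected_confs I j w
    (q, map \<sigma> [0..<n] @ [\<sigma> n]) (q, map \<sigma> [0..<n] @ [\<sigma> (Suc n)]))"
proof -
  let ?V = "{..<n + 2}" and ?c = "[0..<n] @ [n]" and ?d = "[0..<n] @ [Suc n]"
  have closed: "closed_in (dim I q') (univ I q')" "closed_in (Suc n + dim I q') (ordf I q q')"
    "b \<le> m \<Longrightarrow> closed_in (dim I q') (labf I b q')" if "q' \<in> comps I" for q' b
    using wf q that unfolding wf_interp_def by force+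
  define R where "R q' w \<sigma> zs \<longleftrightarrow> (holds w (univ I q') zs \<and> (\<exists>b\<in>{..j}. holds w (labf I b q') zs))
    \<and> (holds w (ordf I q q') (map \<sigma> ?c @ zs) \<and> \<not> holds w (ordf I q q') (map \<sigma> ?d @ zs)
      \<or> holds w (ordf I q q') (map \<sigma> ?d @ zs) \<and> \<not> holds w (ordf I q q') (map \<sigma> ?c @ zs))" for q' w \<sigma> zs
  have ex: "rec_rel ?V (\<lambda>w \<sigma> \<tau>. \<exists>zs. length zs = dim I q' \<and> (\<forall>x\<in>set zs. x < length w) \<and> R q' w \<sigma> zs)"
    if q': "q' \<in> comps I" for q'
  proof (rule rec_rel_ex_list)
    let ?zs = "[n + 2..<n + 2 + dim I q']"
    let ?W = "?V \<union> {n + 2..<n + 2 + dim I q'}"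
    have ord: "rec_rel ?W (\<lambda>w \<sigma> \<tau>. holds w (ordf I q q') (map \<sigma> (xs @ ?zs)))" if "xs = ?c \<or> xs = ?d" for xs
    proof (rule rec_rel_holds)
      have "length (xs @ ?zs) = Suc n + dim I q'"
        using that by auto
      then show "closed_in (length (xs @ ?zs)) (ordf I q q')"
        using closed(2)[OF q'] by simp
    qed (use that in auto)
    have un: "rec_rel ?W (\<lambda>w \<sigma> \<tau>. holds w \<phi> (map \<sigma> ?zs))" if "closed_in (dim I q') \<phi>" for \<phi>
    proof (rule rec_rel_holds)
      show "closed_in (length ?zs) \<phi>"
        using that by (simp only: length_upt add_diff_cancel_left')
    qed auto
    have lab: "rec_rel ?W (\<lambda>w \<sigma> \<tau>. \<exists>b\<in>{..j}. holds w (labf I b q') (map \<sigma> ?zs))"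
      using j by (intro rec_rel_bex un closed(3) q') auto
    show "rec_rel ?W (\<lambda>w \<sigma> \<tau>. R q' w \<sigma> (map \<sigma> ?zs))"
      unfolding R_def map_append[symmetric]
      by (intro rec_rel_conj rec_rel_disj rec_rel_not ord un lab closed(1) q') auto
  next
    fix w \<sigma> \<sigma>' zs
    assume off: "\<And>x. x \<notin> {n + 2..<n + 2 + dim I q'} \<Longrightarrow> \<sigma>' x = (\<sigma> x :: nat)"
    have "map \<sigma>' ?c = map \<sigma> ?c" "map \<sigma>' ?d = map \<sigma> ?d"
      using off by auto
    then show "R q' w \<sigma>' zs = R q' w \<sigma> zs"
      unfolding R_def by (simp only:)
  qed
  have fin: "finite (comps I)"
    using wf by (simp add: wf_interp_def)
  have un: "rec_rel ?V (\<lambda>w \<sigma> \<tau>. holds w (univ I q) (map \<sigma> xs))" if "xs = ?c \<or> xs = ?d" for xs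
    using closed(1)[OF q(1)] q(2) that by (intro rec_rel_holds) auto
  have rec: "rec_rel ?V (\<lambda>w \<sigma> \<tau>. (holds w (univ I q) (map \<sigma> ?c) \<and> holds w (univ I q) (map \<sigma> ?d))
      \<and> \<not> (\<exists>q'\<in>comps I. \<exists>zs. length zs = dim I q' \<and> (\<forall>x\<in>set zs. x < length w) \<and> R q' w \<sigma> zs))"
    by (intro rec_rel_conj rec_rel_not rec_rel_bex[OF fin] ex un) auto
  then obtain L where L: "rec_lang L" "\<And>w \<sigma> \<tau>. (\<And>x. x \<in> ?V \<Longrightarrow> \<sigma> x < length w) \<Longrightarrow>
      ((holds w (univ I q) (map \<sigma> ?c) \<and> holds w (univ I q) (map \<sigma> ?d))
      \<and> \<not> (\<exists>q'\<in>comps I. \<exists>zs. length zs = dim I q' \<and> (\<forall>x\<in>set zs. x < length w) \<and> R q' w \<sigma> zs))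
      = L (encw w (marks ?V \<sigma> \<tau>))"
    unfolding rec_rel_def by blast
  show ?thesis
  proof (rule rec_relI[OF L(1)])
    fix w :: "nat list" and \<sigma> :: "nat \<Rightarrow> nat" and \<tau> :: "nat \<Rightarrow> nat set"
    assume \<sigma>: "\<And>x. x \<in> ?V \<Longrightarrow> \<sigma> x < length w"
    have "(q, map \<sigma> xs) \<in> out_univ I w \<longleftrightarrow> holds w (univ I q) (map \<sigma> xs)" if "xs = ?c \<or> xs = ?d" for xs
      using that q \<sigma> by (auto simp: out_univ_def)
    then have mem: "(q, map \<sigma> ?c) \<in> out_univ I w \<longleftrightarrow> holds w (univ I q) (map \<sigma> ?c)"
      "(q, map \<sigma> ?d) \<in> out_univ I w \<longleftrightarrow> holds w (univ I q) (map \<sigma> ?d)"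
      by blast+
    have "connected_confs I j w (q, map \<sigma> ?c) (q, map \<sigma> ?d) \<longleftrightarrow>
      (holds w (univ I q) (map \<sigma> ?c) \<and> holds w (univ I q) (map \<sigma> ?d))
      \<and> \<not> (\<exists>q'\<in>comps I. \<exists>zs. length zs = dim I q' \<and> (\<forall>x\<in>set zs. x < length w) \<and> R q' w \<sigma> zs)"
      unfolding connected_confs_def mem bex_out_univ R_def out_le_def out_lab_def fst_conv snd_conv conj_assoc
      by (rule refl)
    then show "connected_confs I j w (q, map \<sigma> [0..<n] @ [\<sigma> n]) (q, map \<sigma> [0..<n] @ [\<sigma> (Suc n)])
      = L (encw w (marks ?V \<sigma> \<tau>))"
      using L(2)[OF \<sigma>] by simp
  qed
qed

section \<open>Output positions and configurations\<close>

definition enumerates :: "nat \<Rightarrow> interp \<Rightarrow> nat list \<Rightarrow> (nat \<Rightarrow> nat \<times> nat list) \<Rightarrow> bool" where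
  "enumerates m I w e \<longleftrightarrow> bij_betw e {..<length w * length w} (out_univ I w)
     \<and> (\<forall>i<length w * length w. \<forall>j<length w * length w. i \<le> j \<longleftrightarrow> out_le I w (e i) (e j))
     \<and> (\<forall>i<length w * length w. \<forall>b\<in>{..m}. out_lab I w b (e i) \<longleftrightarrow> b = interleave m w ! i)"

lemma computes_enumerates:
  assumes "computes {..m} {..m} I (interleave m)" "w \<in> lists {..m}"
  obtains e where "enumerates m I w e"
proof -
  have "\<forall>w\<in>lists {..m}. \<exists>e. enumerates m I w e"
    using assms(1) by (simp add: computes_def enumerates_def)
  then show ?thesis using assms(2) that by metis
qed

lemma enumerates_bij: "enumerates m I w e \<Longrightarrow> bij_betw e {..<length w * length w} (out_univ I w)"
  unfolding enumerates_def by (rule conjunct1)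

lemma enumerates_in: "enumerates m I w e \<Longrightarrow> i < length w * length w \<Longrightarrow> e i \<in> out_univ I w"
  using bij_betwE[OF enumerates_bij] by blast

lemma enumerates_ex:
  assumes "enumerates m I w e" "c \<in> out_univ I w"
  obtains i where "i < length w * length w" "e i = c"
proof -
  have "c \<in> e ` {..<length w * length w}"
    using assms(2) bij_betw_imp_surj_on[OF enumerates_bij[OF assms(1)]] by simp
  then show ?thesis
    by (rule imageE) (simp add: that)
qed

lemma enumerates_inj: "enumerates m I w e \<Longrightarrow> inj_on e {..<length w * length w}"
  using enumerates_bij by (rule bij_betw_imp_inj_on)

lemma enumerates_le:
  "enumerates m I w e \<Longrightarrow> i < length w * length w \<Longrightarrow> j < length w * length w \<Longrightarrow> out_le I w (e i) (e j) \<longleftrightarrow> i \<le> j"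
  unfolding enumerates_def by blast

lemma enumerates_lab:
  "enumerates m I w e \<Longrightarrow> i < length w * length w \<Longrightarrow> b \<le> m \<Longrightarrow> out_lab I w b (e i) \<longleftrightarrow> b = interleave m w ! i"
  unfolding enumerates_def by blast

lemma connected_confs_sym: "connected_confs I j w c d \<Longrightarrow> connected_confs I j w d c"
  unfolding connected_confs_def by blast

text \<open>Between different cells there is a label at most j, output by a configuration that
  separates the two. The symmetry of connectedness reduces the claim to a \<le> b.\<close>

lemma connected_same_cell:
  assumes w: "w \<in> lists {..m}" "last w = 0" and j: "j \<le> m" and e: "enumerates m I w e"
    and ab: "a < length w * length w" "b < length w * length w"
    and conn: "connected_confs I j w (e a) (e b)"
  shows "cell m w j a = cell m w j b"
proof -
  have main: "cell m w j a = cell m w j b"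
    if ab: "a \<le> b" "b < length w * length w" and conn: "connected_confs I j w (e a) (e b)" for a b
  proof (rule ccontr)
    assume "cell m w j a \<noteq> cell m w j b"
    then obtain i where i: "a \<le> i" "i < b" "interleave m w ! i \<le> j"
      using label_between_cells[OF w j ab] by metis
    then have len: "i < length w * length w" "a < length w * length w"
      using ab by auto
    have "out_lab I w (interleave m w ! i) (e i)"
      using enumerates_lab[OF e len(1), of "interleave m w ! i"] i(3) j by simp
    moreover have "out_le I w (e a) (e i)" "\<not> out_le I w (e b) (e i)"
      using i enumerates_le[OF e] len ab(2) by auto
    ultimately show False
      using conn i(3) enumerates_in[OF e len(1)] unfolding connected_confs_def by blast
  qed
  show ?thesis
    using main[OF _ ab(2) conn] main[OF _ ab(1) connected_confs_sym[OF conn]] by (metis nat_le_linear)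
qed

text \<open>A separating configuration would output a label at most j strictly before the end of the
  common cell.\<close>

lemma same_cell_connected:
  assumes w: "w \<in> lists {..m}" and j: "j \<le> m" and e: "enumerates m I w e"
    and ab: "a < length w * length w" "b < length w * length w" "cell m w j a = cell m w j b"
  shows "connected_confs I j w (e a) (e b)"
proof -
  have main: "\<not> (out_le I w (e a) z \<and> \<not> out_le I w (e b) z)"
    if z: "z \<in> out_univ I w" "out_lab I w c z" "c \<le> j"
      and ab: "a < length w * length w" "b < length w * length w" "cell m w j a = cell m w j b" for a b z c
  proof -
    obtain i where i: "i < length w * length w" "e i = z"
      using enumerates_ex[OF e z(1)] .
    then have "interleave m w ! i \<le> j"
      using enumerates_lab[OF e i(1), of c] z j by simp
    then show ?thesis
      using no_label_in_cell[OF w j _ _ ab(2,3), of i] enumerates_le[OF e] i ab by (metis not_le)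
  qed
  show ?thesis
    unfolding connected_confs_def
  proof (intro conjI notI)
    assume "\<exists>z\<in>out_univ I w. (\<exists>c\<in>{..j}. out_lab I w c z)
      \<and> (out_le I w (e a) z \<and> \<not> out_le I w (e b) z \<or> out_le I w (e b) z \<and> \<not> out_le I w (e a) z)"
    then obtain z c where "z \<in> out_univ I w" "out_lab I w c z" "c \<le> j"
      "out_le I w (e a) z \<and> \<not> out_le I w (e b) z \<or> out_le I w (e b) z \<and> \<not> out_le I w (e a) z"
      by blast
    then show False
      using main[of z c a b] main[of z c b a] ab(1,2) ab(3)[symmetric] ab(3) by blast
  qed (rule enumerates_in[OF e ab(1)], rule enumerates_in[OF e ab(2)])
qed

section \<open>Pumping inside a cell\<close>

lemma nth_concat_replicate:
  "u < r * length xs \<Longrightarrow> concat (replicate r xs) ! u = xs ! (u mod length xs)"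
proof (induction r arbitrary: u)
  case (Suc r)
  show ?case
  proof (cases "u < length xs")
    case False
    then have "concat (replicate r xs) ! (u - length xs) = xs ! ((u - length xs) mod length xs)"
      using Suc.prems by (intro Suc.IH) auto
    then show ?thesis
      using False by (simp add: nth_append le_mod_geq)
  qed (simp add: nth_append)
qed simp

text \<open>Folding the copies of the factor back onto w is injective on a block, since any l consecutive
  positions of the repeated part contain the end of a block.\<close>

lemma card_block_pumped:
  assumes p: "p < p'" "p' < length w" and z: "p \<le> z" "z < p'" "w ! z \<le> j" and r: "r \<ge> 1"
  shows "card {x. x < length (pumped r p p' w) \<and> blk (pumped r p p' w) j x = b} \<le> length w"
proof -
  define v l where "v = pumped r p p' w" and "l = p' - p"
  have l: "l > 0" "p' = p + l" using p by (simp_all add: l_def)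
  have len_\<eta>: "length (take l (drop p w)) = l" using p by (simp add: l_def)
  have lv: "length v = p + (r * l + (length w - p'))"
    unfolding v_def pumped_def l_def[symmetric] length_append length_concat_replicate len_\<eta> using p by simp
  have v_mid: "v ! (p + u) = w ! (p + u mod l)" if "u < r * l" for u
  proof -
    have "v ! (p + u) = (concat (replicate r (take l (drop p w))) @ drop p' w) ! u"
      unfolding v_def pumped_def l_def[symmetric] using p by (simp add: nth_append)
    also have "\<dots> = take l (drop p w) ! (u mod l)"
      using that by (simp only: nth_append length_concat_replicate len_\<eta> nth_concat_replicate if_True)
    also have "\<dots> = w ! (p + u mod l)"
      using l p by simp
    finally show ?thesis .
  qed
  define f where "f x = (if x < p then x else if x < p + r * l then p + (x - p) mod l else x - (r - 1) * l)" for x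
  have rl: "r * l = l + (r - 1) * l" using r by (cases r) auto
  have mod_l: "u mod l < l" for u using l by simp
  have f1: "f x = x" if "x < p" for x
    using that by (simp add: f_def)
  have f2: "p \<le> f x" "f x < p + l" if "p \<le> x" "x < p + r * l" for x
    using that mod_l[of "x - p"] by (simp_all add: f_def)
  have f3: "f x = x - (r - 1) * l" "p + l \<le> f x" if "p + r * l \<le> x" for x
    using that rl by (simp_all add: f_def)
  let ?X = "{x. x < length v \<and> blk v j x = b}"
  have neq: "f x \<noteq> f y" if "x < y" "y < length v" "blk v j x = blk v j y" for x y
  proof
    assume eq: "f x = f y"
    \<comment> \<open>Outside the repeated part \<open>f\<close> is injective and its values avoid
      the factor, so a collision must lie within the copies.\<close>
    have x: "p \<le> x"
      using f1[of x] f1[of y] f2(1)[of y] f3(2)[of y] eq that(1) by linarith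
    moreover have "y < p + r * l"
      using f2(2)[of x] f3[of x] f3[of y] eq that(1) x rl by linarith
    ultimately have mid: "p \<le> x" "y < p + r * l"
      by simp_all
    then have m: "(x - p) mod l = (y - p) mod l"
      using eq that(1) by (simp add: f_def)
    define u o' where "u = x - p" and "o' = z - p"
    have "l dvd (y - p) - (x - p)"
      using m that(1) mid by (metis diff_le_mono less_imp_le_nat mod_eq_dvd_iff_nat)
    then have ly: "u + l \<le> y - p"
      using that(1) mid l by (auto simp: u_def dest!: dvd_imp_le)
    \<comment> \<open>The least number from u on that is congruent to \<open>o'\<close> modulo l.
      There v carries the letter \<open>w ! z\<close>, so a block ends between x and y.\<close>
    define u' where "u' = l * (u div l) + o' + (if u mod l \<le> o' then 0 else l)"
    have o': "o' < l" using z l by (simp add: o'_def)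
    have u: "l * (u div l) + u mod l = u" by simp
    have "u \<le> u' \<and> u' < u + l"
    proof (cases "u mod l \<le> o'")
      case True
      then have "u' = l * (u div l) + o'" by (simp add: u'_def)
      then show ?thesis using u o' True by linarith
    next
      case False
      then have "u' = l * (u div l) + o' + l" by (simp add: u'_def)
      then show ?thesis using u mod_l[of u] False by linarith
    qed
    then have u': "u \<le> u'" "u' < u + l" by simp_all
    have "u' mod l = o'"
      using o' by (auto simp: u'_def)
    moreover have "u' < r * l"
      using u'(2) ly mid by simp
    ultimately have "v ! (p + u') \<le> j"
      using v_mid[of u'] z by (simp add: o'_def)
    then have "blk v j x < blk v j y"
      unfolding blk_less_iff using u' ly mid by (intro exI[of _ "p + u'"]) (auto simp: u_def)
    then show False using that(3) by simp
  qed
  have "card ?X \<le> card {..<length w}"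
  proof (rule card_inj_on_le[of f])
    show "inj_on f ?X"
    proof (rule inj_onI)
      fix x y assume "x \<in> ?X" "y \<in> ?X" "f x = f y"
      then show "x = y" using neq[of x y] neq[of y x] by (cases x y rule: linorder_cases) auto
    qed
    show "f ` ?X \<subseteq> {..<length w}"
    proof (rule image_subsetI)
      fix x assume "x \<in> ?X"
      then show "f x \<in> {..<length w}"
        using p l lv rl mod_l[of "x - p"] unfolding f_def by auto
    qed
  qed simp
  then show ?thesis
    by (simp add: v_def)
qed

lemma pumped_lists: "w \<in> lists A \<Longrightarrow> pumped r p p' w \<in> lists A"
  unfolding pumped_def lists_eq_set by (auto dest!: in_set_takeD in_set_dropD)

lemma last_pumped: "p' < length w \<Longrightarrow> last (pumped r p p' w) = last w"
  unfolding pumped_def by simp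

text \<open>Otherwise two of the configurations could be pumped, which puts arbitrarily many configurations
  into a cell of bounded size.\<close>

lemma blocks_in_cell_bounded:
  assumes comp: "computes {..m} {..m} I (interleave m)"
    and j: "j \<le> m" and q: "q \<in> comps I" "dim I q = Suc n"
  shows "\<exists>C. \<forall>w e ps D c. w \<in> lists {..m} \<longrightarrow> last w = 0 \<longrightarrow> enumerates m I w e \<longrightarrow>
    length ps = n \<longrightarrow> (\<forall>x\<in>set ps. x < length w) \<longrightarrow>
    (\<forall>p\<in>D. p < length w \<and> (\<exists>a<length w * length w. e a = (q, ps @ [p]) \<and> cell m w j a = c)) \<longrightarrow>
    card (blk w j ` D) \<le> C"
proof -
  have "wf_interp {..m} I"
    using comp by (simp add: computes_def)
  note rec = rec_rel_connected_confs[OF this j q]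
  from pumping[OF rec] obtain C where C: "\<And>w ps P. length ps = n \<Longrightarrow> \<forall>x\<in>set ps. x < length w \<Longrightarrow>
    P \<subseteq> {..<length w} \<Longrightarrow> C < card P \<Longrightarrow>
    \<exists>p\<in>P. \<exists>p'\<in>P. p < p' \<and> (connected_confs I j w (q, ps @ [p]) (q, ps @ [p']) \<longrightarrow>
      (\<forall>r\<ge>1. \<exists>ps'. length ps' = n \<and> (\<forall>i<r. connected_confs I j (pumped r p p' w)
         (q, ps' @ [p + i * (p' - p)]) (q, ps' @ [p + Suc i * (p' - p)]))))"
    by blast
  show ?thesis
  proof (intro exI[of _ C] allI impI)
    fix w e ps D c
    assume w: "w \<in> lists {..m}" "last w = 0" and e: "enumerates m I w e"
      and ps: "length ps = n" "\<forall>x\<in>set ps. x < length w"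
      and D: "\<forall>p\<in>D. p < length w \<and> (\<exists>a<length w * length w. e a = (q, ps @ [p]) \<and> cell m w j a = c)"
    show "card (blk w j ` D) \<le> C"
    proof (rule ccontr)
      assume big: "\<not> card (blk w j ` D) \<le> C"
      \<comment> \<open>One representative position for each visited block, so that two pumpable
        positions lie in different blocks.\<close>
      obtain P where P: "P \<subseteq> D" "inj_on (blk w j) P" "blk w j ` D = blk w j ` P"
        using subset_image_inj[of "blk w j ` D" "blk w j" D] by blast
      then have "C < card P"
        using big card_image[OF P(2)] by simp
      moreover have "P \<subseteq> {..<length w}"
        using P(1) D by auto
      ultimately obtain p p' where pp: "p \<in> P" "p' \<in> P" "p < p'"
        and pump: "connected_confs I j w (q, ps @ [p]) (q, ps @ [p']) \<Longrightarrow>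
          \<forall>r\<ge>1. \<exists>ps'. length ps' = n \<and> (\<forall>i<r. connected_confs I j (pumped r p p' w)
           (q, ps' @ [p + i * (p' - p)]) (q, ps' @ [p + Suc i * (p' - p)]))"
        using C[OF ps, of P] by blast
      obtain a where a: "a < length w * length w" "e a = (q, ps @ [p])" "cell m w j a = c"
        using D P(1) pp(1) by blast
      obtain a' where a': "a' < length w * length w" "e a' = (q, ps @ [p'])" "cell m w j a' = c"
        using D P(1) pp(2) by blast
      have p'w: "p' < length w" using D P(1) pp(2) by blast
      have "blk w j p \<noteq> blk w j p'"
        using P(2) pp by (auto simp: inj_on_def)
      then have "blk w j p < blk w j p'"
        using blk_mono[of p p' w j] pp(3) by simp
      \<comment> \<open>A block end within the factor; it is what keeps the blocks of the pumped
        word short.\<close>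
      then obtain z where z: "p \<le> z" "z < p'" "w ! z \<le> j"
        by (auto simp: blk_less_iff)
      \<comment> \<open>One more than the bound on the size of a cell of the pumped word, which does
        not depend on the number of copies.\<close>
      define r where "r = Suc (length w * length w)"
      define v where "v = pumped r p p' w"
      have "connected_confs I j w (q, ps @ [p]) (q, ps @ [p'])"
        using same_cell_connected[OF w(1) j e a(1) a'(1)] a a' by simp
      from pump[OF this] obtain ps' where conn: "connected_confs I j v
           (q, ps' @ [p + i * (p' - p)]) (q, ps' @ [p + Suc i * (p' - p)])" if "i < r" for i
        unfolding v_def by (metis One_nat_def Suc_le_mono le0 r_def)
      have v: "v \<in> lists {..m}" "last v = 0"
        using pumped_lists[OF w(1)] last_pumped[OF p'w] w(2) by (simp_all add: v_def)
      obtain e' where e': "enumerates m I v e'"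
        using computes_enumerates[OF comp v(1)] .
      let ?conf = "\<lambda>i. (q, ps' @ [p + i * (p' - p)])"
      have "\<exists>i. i < length v * length v \<and> e' i = ?conf t" if "t < r" for t
        using conn[OF that] enumerates_ex[OF e', of "?conf t"] unfolding connected_confs_def by metis
      then obtain g where g: "\<And>t. t < r \<Longrightarrow> g t < length v * length v \<and> e' (g t) = ?conf t"
        by metis
      \<comment> \<open>Pumping only connects heads in adjacent copies; being in the same cell is
        transitive and so links all \<open>r\<close> of them.\<close>
      have step: "cell m v j (g t) = cell m v j (g (Suc t))" if "Suc t < r" for t
        using connected_same_cell[OF v j e', of "g t" "g (Suc t)"] g[of t] g[of "Suc t"] conn[of t] that
        by simp
      have same: "cell m v j (g t) = cell m v j (g 0)" if "t < r" for t
        using that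
      proof (induction t)
        case (Suc t)
        then show ?case using step[of t] by simp
      qed simp
      have "inj_on g {..<r}"
      proof (rule inj_onI)
        fix s t assume st: "s \<in> {..<r}" "t \<in> {..<r}" "g s = g t"
        then have "?conf s = ?conf t"
          using g[of s] g[of t] by (metis lessThan_iff)
        then show "s = t" using pp(3) by simp
      qed
      moreover have "g ` {..<r} \<subseteq> {i. i < length v * length v \<and> cell m v j i = cell m v j (g 0)}"
        using g same by auto
      ultimately have "card {..<r} \<le> card {i. i < length v * length v \<and> cell m v j i = cell m v j (g 0)}"
        by (intro card_inj_on_le) auto
      also have "\<dots> \<le> length w * length w"
        unfolding v_def
        using card_block_pumped[OF pp(3) p'w z, of r] by (intro card_cell_le) (simp add: r_def)
      finally show False
        by (simp add: r_def)
    qed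
  qed
qed

section \<open>Uniform words\<close>

text \<open>The word of length \<open>s 0\<close> whose level-j blocks all have length \<open>s j\<close>.\<close>

definition uniform_word :: "(nat \<Rightarrow> nat) \<Rightarrow> nat list" where
  "uniform_word s = map (\<lambda>p. LEAST j. s j dvd Suc p) [0..<s 0]"

locale uniform =
  fixes m :: nat and s :: "nat \<Rightarrow> nat"
  assumes dvd: "\<And>j. j < m \<Longrightarrow> s (Suc j) dvd s j" and s_m: "s m = 1" and s_0: "s 0 > 0"
begin

lemma chain_dvd:
  assumes "i \<le> j" "j \<le> m"
  shows "s j dvd s i"
  using assms
proof (induction j rule: dec_induct)
  case (step j)
  then show ?case using dvd[of j] by (auto intro: dvd_trans)
qed simp

lemma s_pos: "j \<le> m \<Longrightarrow> s j > 0"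
  using chain_dvd[of 0 j] s_0 by (auto intro: dvd_pos_nat)

lemma length_uniform [simp]: "length (uniform_word s) = s 0"
  by (simp add: uniform_word_def)

text \<open>By the divisibility chain, the levels whose block length divides \<open>Suc p\<close>
  are upward closed up to m, and m is among them. The least one therefore determines all. The
  successor appears because positions start at 0 and a letter ends its block.\<close>

lemma letter_le_iff:
  assumes "p < s 0" "j \<le> m"
  shows "uniform_word s ! p \<le> j \<longleftrightarrow> s j dvd Suc p"
proof -
  have nth: "uniform_word s ! p = (LEAST j. s j dvd Suc p)"
    using assms(1) by (simp add: uniform_word_def)
  have "s m dvd Suc p" by (simp add: s_m)
  then have "s (uniform_word s ! p) dvd Suc p"
    unfolding nth by (rule LeastI)
  then have "s j dvd Suc p" if "uniform_word s ! p \<le> j"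
    using chain_dvd[OF that assms(2)] dvd_trans by blast
  moreover have "uniform_word s ! p \<le> j" if "s j dvd Suc p"
    unfolding nth using that by (rule Least_le)
  ultimately show ?thesis by blast
qed

lemma uniform_in_lists: "uniform_word s \<in> lists {..m}"
  using letter_le_iff[of _ m] by (auto simp: in_set_conv_nth s_m)

lemma last_uniform: "last (uniform_word s) = 0"
proof -
  have "uniform_word s \<noteq> []"
    using s_0 by (auto simp: uniform_word_def)
  then have "last (uniform_word s) = uniform_word s ! (s 0 - 1)"
    by (simp add: last_conv_nth)
  also have "\<dots> \<le> 0"
    using s_0 by (subst letter_le_iff) auto
  finally show ?thesis by simp
qed

lemma blk_uniform:
  assumes "j \<le> m" "x \<le> s 0"
  shows "blk (uniform_word s) j x = x div s j"
  using assms(2)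
proof (induction x)
  case (Suc x)
  then have "blk (uniform_word s) j (Suc x) = x div s j + (if s j dvd Suc x then 1 else 0)"
    using letter_le_iff[OF _ assms(1), of x] by (simp add: blk_Suc)
  then show ?case
    by (simp add: div_Suc dvd_eq_mod_eq_0)
qed simp

lemma cell_uniform:
  assumes "j \<le> m" "a < s 0 * s 0"
  shows "cell m (uniform_word s) j a =
    (fst (pairs m (uniform_word s) ! a) div s j, snd (pairs m (uniform_word s) ! a) div s j)"
proof -
  have "fst (pairs m (uniform_word s) ! a) < s 0" "snd (pairs m (uniform_word s) ! a) < s 0"
    using pairs_nth_less[of a "uniform_word s" m] assms(2) by simp_all
  then show ?thesis
    by (simp add: cell_def blk_uniform assms(1))
qed

lemma card_block_uniform:
  assumes "j \<le> m"
  shows "card {x. x < s 0 \<and> x div s j = v} \<le> s j"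
proof -
  have "{x. x < s 0 \<and> x div s j = v} \<subseteq> {v * s j..<v * s j + s j}"
    using dividend_less_div_times[OF s_pos[OF assms]] by (auto simp: add.commute)
  then show ?thesis
    using card_mono[of "{v * s j..<v * s j + s j}"] by fastforce
qed

lemma card_le_blocks:
  assumes "j \<le> m" "D \<subseteq> {..<s 0}"
  shows "card D \<le> card (blk (uniform_word s) j ` D) * s j"
proof -
  let ?B = "blk (uniform_word s) j ` D"
  have fin: "finite D" using assms(2) finite_subset by blast
  have "D \<subseteq> (\<Union>v\<in>?B. {x. x < s 0 \<and> x div s j = v})"
  proof
    fix x assume x: "x \<in> D"
    then have "x < s 0" using assms(2) by auto
    then show "x \<in> (\<Union>v\<in>?B. {x. x < s 0 \<and> x div s j = v})"
      using blk_uniform[OF assms(1), of x] by (intro UN_I[OF imageI[OF x]]) auto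
  qed
  then have "card D \<le> card (\<Union>v\<in>?B. {x. x < s 0 \<and> x div s j = v})"
    using fin by (intro card_mono) auto
  also have "\<dots> \<le> (\<Sum>v\<in>?B. card {x. x < s 0 \<and> x div s j = v})"
    using fin by (intro card_UN_le) simp
  also have "\<dots> \<le> card ?B * s j"
    using sum_bounded_above[of ?B "\<lambda>v. card {x. x < s 0 \<and> x div s j = v}" "s j"]
      card_block_uniform[OF assms(1)] by simp
  finally show ?thesis .
qed

end

section \<open>The lower bound\<close>

lemma enumerates_consecutive:
  assumes e: "enumerates m I w e" and i: "Suc i < length w * length w"
  shows "consecutive I w (e i) (e (Suc i))"
proof -
  have "e i \<noteq> e (Suc i)"
    using inj_onD[OF enumerates_inj[OF e], of i "Suc i"] i by auto
  moreover have "x = e i \<or> x = e (Suc i)"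
    if x: "x \<in> out_univ I w" "out_le I w (e i) x" "out_le I w x (e (Suc i))" for x
  proof -
    obtain t where t: "t < length w * length w" "e t = x"
      using enumerates_ex[OF e x(1)] .
    then have "i \<le> t" "t \<le> Suc i"
      using x(2,3) i enumerates_le[OF e, of i t] enumerates_le[OF e, of t "Suc i"] by auto
    then show ?thesis
      using t(2) by (auto simp: le_Suc_eq)
  qed
  ultimately show ?thesis
    unfolding consecutive_def
    using enumerates_in[OF e, of i] enumerates_in[OF e i] enumerates_le[OF e _ i, of i] i by auto
qed

text \<open>Pushing and popping affect only entries beyond the shorter stack, and moving the head
  affects only the last entry. When both stacks are higher than h, none of this reaches the first h
  entries.\<close>

lemma take_eq_of_stack_step:
  assumes "prefix xs ys \<or> prefix ys xs \<or> length xs = length ys \<and> butlast xs = butlast ys"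
    and "h < length xs" "h < length ys"
  shows "take h xs = take h ys"
  using assms by (auto simp: prefix_def) (metis take_butlast)

text \<open>Cells are intervals of the output, so all steps from one configuration of the cell to
  another stay where the height bound is known.\<close>

lemma stack_constant_in_cell:
  assumes e: "enumerates m I w e" and w: "w \<in> lists {..m}" and j: "j \<le> m"
    and sd: "stack_discipline {..m} I"
    and high: "\<And>a. a < length w * length w \<Longrightarrow> cell m w j a = c \<Longrightarrow> h < length (snd (e a))"
    and ab: "a < length w * length w" "cell m w j a = c" "b < length w * length w" "cell m w j b = c"
  shows "take h (snd (e a)) = take h (snd (e b))"
proof -
  have main: "take h (snd (e a)) = take h (snd (e b))"
    if "a \<le> b" "b < length w * length w" "cell m w j a = c" "cell m w j b = c" for a b
  proof -
    have between: "i < length w * length w \<and> cell m w j i = c" if "a \<le> i" "i \<le> b" for i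
      using cell_contiguous[OF w j, of a b i] that \<open>b < length w * length w\<close>
        \<open>cell m w j a = c\<close> \<open>cell m w j b = c\<close> by simp
    have "i \<le> b \<longrightarrow> take h (snd (e a)) = take h (snd (e i))" if "a \<le> i" for i
      using that
    proof (induction i rule: dec_induct)
      case (step i)
      show ?case
      proof
        assume i: "Suc i \<le> b"
        have "consecutive I w (e i) (e (Suc i))"
          using enumerates_consecutive[OF e] between[of "Suc i"] i step(1) by simp
        then have "prefix (snd (e i)) (snd (e (Suc i))) \<or> prefix (snd (e (Suc i))) (snd (e i))
            \<or> length (snd (e i)) = length (snd (e (Suc i))) \<and> butlast (snd (e i)) = butlast (snd (e (Suc i)))"
          using sd w unfolding stack_discipline_def by blast
        moreover have "h < length (snd (e i))" "h < length (snd (e (Suc i)))"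
          using high between[of i] between[of "Suc i"] i step(1) by simp_all
        ultimately have "take h (snd (e i)) = take h (snd (e (Suc i)))"
          by (rule take_eq_of_stack_step)
        then show "take h (snd (e a)) = take h (snd (e (Suc i)))"
          using step(3) i by simp
      qed
    qed simp
    then show ?thesis using \<open>a \<le> b\<close> by simp
  qed
  show ?thesis
    using main[OF _ ab(3,2,4)] main[OF _ ab(1,4,2)] by (metis nat_le_linear)
qed

text \<open>Lengths are built from the finest level upwards. If b is one length, the next is
  \<open>N * b\<close> with \<open>N = K * b + 1\<close>; this makes \<open>K * (N * b)\<close>, the
  bound on the stacks of the critical height, smaller than the number \<open>N * N\<close> of
  subcells.\<close>

fun block_size :: "nat \<Rightarrow> nat \<Rightarrow> nat" where
  "block_size K 0 = 1"
| "block_size K (Suc i) = (K * block_size K i + 1) * block_size K i"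

lemma not_k_pebble_interleave:
  assumes "k_pebble_computes k {..Suc k} {..Suc k} I (interleave (Suc k))"
  shows False
proof -
  define m where "m = Suc k"
  have comp: "computes {..m} {..m} I (interleave m)" and sd: "stack_discipline {..m} I"
    and dimk: "\<And>q. q \<in> comps I \<Longrightarrow> dim I q \<le> k"
    using assms unfolding k_pebble_computes_def m_def by blast+
  have fin: "finite (comps I)"
    using comp by (simp add: computes_def wf_interp_def)
  \<comment> \<open>A component is counted only at the level equal to its dimension, so one constant
    per component suffices.\<close>
  have "\<exists>C. \<forall>n. dim I q = Suc n \<longrightarrow> (\<forall>w e ps D c. w \<in> lists {..m} \<longrightarrow> last w = 0 \<longrightarrow> enumerates m I w e \<longrightarrow>
    length ps = n \<longrightarrow> (\<forall>x\<in>set ps. x < length w) \<longrightarrow>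
    (\<forall>p\<in>D. p < length w \<and> (\<exists>a<length w * length w. e a = (q, ps @ [p]) \<and> cell m w (Suc n) a = c)) \<longrightarrow>
    card (blk w (Suc n) ` D) \<le> C)" if "q \<in> comps I" for q
  proof (cases "dim I q")
    case (Suc n)
    then have "Suc n \<le> m"
      using dimk[OF that] by (simp add: m_def)
    from blocks_in_cell_bounded[OF comp this that Suc] show ?thesis
      unfolding Suc by blast
  qed simp
  then obtain C where C: "\<And>q n w e ps D c. q \<in> comps I \<Longrightarrow> dim I q = Suc n \<Longrightarrow> w \<in> lists {..m} \<Longrightarrow>
    last w = 0 \<Longrightarrow> enumerates m I w e \<Longrightarrow> length ps = n \<Longrightarrow> \<forall>x\<in>set ps. x < length w \<Longrightarrow>
    \<forall>p\<in>D. p < length w \<and> (\<exists>a<length w * length w. e a = (q, ps @ [p]) \<and> cell m w (Suc n) a = c) \<Longrightarrow>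
    card (blk w (Suc n) ` D) \<le> C q"
    by metis
  \<comment> \<open>The successor covers components of dimension 0, which have no head to pump but
    still contribute one configuration.\<close>
  define K where "K = (\<Sum>q\<in>comps I. Suc (C q))"
  define s where "s j = block_size K (m - j)" for j
  have s_step: "s j = (K * s (Suc j) + 1) * s (Suc j)" if "j < m" for j
    using that by (simp add: s_def Suc_diff_Suc[symmetric])
  have bs_pos: "block_size K i > 0" for i
    by (induction i) auto
  interpret uniform m s
    by unfold_locales (auto simp: s_step, simp_all add: s_def bs_pos)
  define w where "w = uniform_word s"
  have w: "w \<in> lists {..m}" "last w = 0" "length w = s 0"
    using uniform_in_lists last_uniform by (simp_all add: w_def)
  obtain e where e: "enumerates m I w e"
    using computes_enumerates[OF comp w(1)] .
  let ?n = "length w * length w"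
  have conf: "fst (e a) \<in> comps I" "length (snd (e a)) = dim I (fst (e a))" "\<forall>x\<in>set (snd (e a)). x < length w"
    if "a < ?n" for a
    using enumerates_in[OF e that] by (auto simp: out_univ_def)
  have few: "card {a. a < ?n \<and> cell m w h a = c \<and> length (snd (e a)) = h} \<le> K * s h" (is "card ?B \<le> _")
    if h: "h \<le> m" and high: "\<And>a. a < ?n \<Longrightarrow> cell m w h a = c \<Longrightarrow> h \<le> length (snd (e a))" for h c
  proof -
    define B where "B q = {a. a < ?n \<and> cell m w h a = c \<and> length (snd (e a)) = h \<and> fst (e a) = q}" for q
    have B_fin: "finite (B q)" for q
      by (rule finite_subset[of _ "{..<?n}"]) (auto simp: B_def)
    have "card (B q) \<le> Suc (C q) * s h" if q: "q \<in> comps I" for q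
    proof (cases h)
      case 0
      have "a = b" if "a \<in> B q" "b \<in> B q" for a b
        using that 0 enumerates_inj[OF e] by (auto simp: B_def inj_on_def prod_eq_iff)
      then have "card (B q) \<le> 1"
        using B_fin by (auto simp: card_le_Suc0_iff_eq)
      then show ?thesis
        using s_pos[OF h] by (simp add: le_trans[OF _ le_add1])
    next
      case (Suc n)
      show ?thesis
      proof (cases "B q = {}")
        case False
        then obtain a0 where a0: "a0 \<in> B q" by blast
        then have dimq: "dim I q = Suc n"
          using conf(2)[of a0] Suc by (auto simp: B_def)
        define ps where "ps = take n (snd (e a0))"
        have len_a0: "length (snd (e a0)) = Suc n"
          using a0 Suc by (simp add: B_def)
        have ps: "length ps = n" "\<forall>x\<in>set ps. x < length w"
          using len_a0 a0 conf(3)[of a0] by (auto simp: ps_def B_def dest: in_set_takeD)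
        \<comment> \<open>Within the cell all entries below the head are frozen, so the head alone
          identifies a configuration of component q.\<close>
        have ea: "e a = (q, ps @ [last (snd (e a))])" if a: "a \<in> B q" for a
        proof -
          have "take n (snd (e a)) = ps"
            unfolding ps_def using a a0 high Suc
            by (intro stack_constant_in_cell[OF e w(1) h sd]) (auto simp: B_def Suc_le_eq)
          moreover have "length (snd (e a)) = Suc n"
            using a Suc by (simp add: B_def)
          ultimately have "snd (e a) = ps @ [last (snd (e a))]"
            by (metis append_butlast_last_id butlast_conv_take diff_Suc_1 list.size(3) nat.distinct(1))
          then show ?thesis
            using a by (auto simp: B_def prod_eq_iff)
        qed
        define D where "D = (\<lambda>a. last (snd (e a))) ` B q"
        have inj: "inj_on (\<lambda>a. last (snd (e a))) (B q)"
        proof (rule inj_onI)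
          fix a b assume ab: "a \<in> B q" "b \<in> B q" "last (snd (e a)) = last (snd (e b))"
          then have "e a = e b"
            using ea[OF ab(1)] ea[OF ab(2)] by simp
          then show "a = b"
            using ab enumerates_inj[OF e] by (auto simp: B_def inj_on_def)
        qed
        have D: "\<forall>p\<in>D. p < length w \<and> (\<exists>a<?n. e a = (q, ps @ [p]) \<and> cell m w (Suc n) a = c)"
        proof
          fix p assume "p \<in> D"
          then obtain a where a: "a \<in> B q" "p = last (snd (e a))"
            by (auto simp: D_def)
          then have "a < ?n" "cell m w (Suc n) a = c"
            using Suc by (auto simp: B_def)
          moreover have eap: "e a = (q, ps @ [p])"
            using ea[OF a(1)] a(2) by simp
          moreover have "p < length w"
            using conf(3)[OF \<open>a < ?n\<close>] unfolding eap by simp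
          ultimately show "p < length w \<and> (\<exists>a<?n. e a = (q, ps @ [p]) \<and> cell m w (Suc n) a = c)"
            by blast
        qed
        have "card (B q) = card D"
          unfolding D_def using card_image[OF inj] by simp
        also have "\<dots> \<le> card (blk w h ` D) * s h"
          unfolding w_def using D w(3) by (intro card_le_blocks h) auto
        also have "card (blk w h ` D) \<le> C q"
          using C[OF q dimq w(1,2) e ps D] Suc by simp
        finally show ?thesis by simp
      qed simp
    qed
    moreover have "?B = (\<Union>q\<in>comps I. B q)"
      using conf(1) by (auto simp: B_def)
    ultimately have "card ?B \<le> (\<Sum>q\<in>comps I. Suc (C q) * s h)"
      using card_UN_le[OF fin, of B] sum_mono[of "comps I" "\<lambda>q. card (B q)" "\<lambda>q. Suc (C q) * s h"]
      by fastforce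
    also have "\<dots> = K * s h"
      unfolding K_def sum_distrib_right ..
    finally show ?thesis .
  qed
  \<comment> \<open>The bounds on X and Y make the cell nonempty; otherwise the claim on heights
    could hold vacuously.\<close>
  have "\<exists>X Y. X < s 0 div s h \<and> Y < s 0 div s h \<and>
    (\<forall>a<?n. cell m w h a = (X, Y) \<longrightarrow> h \<le> length (snd (e a)))" if "h \<le> m" for h
    using that
  proof (induction h)
    case 0
    then show ?case
      using s_0 by (intro exI[of _ 0]) auto
  next
    case (Suc h)
    then obtain X Y where XY: "X < s 0 div s h" "Y < s 0 div s h"
      and high: "\<And>a. a < ?n \<Longrightarrow> cell m w h a = (X, Y) \<Longrightarrow> h \<le> length (snd (e a))"
      by auto
    \<comment> \<open>The number of level-(h + 1) blocks in a level-h block: the subcells of (X, Y)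
      are (X * N + i, Y * N + i') with i, i' < N.\<close>
    define N where "N = K * s (Suc h) + 1"
    have sN: "s h = s (Suc h) * N"
      using s_step[of h] Suc.prems by (simp add: N_def mult.commute)
    have pos: "s (Suc h) > 0"
      using s_pos Suc.prems by simp
    have s0: "s 0 div s (Suc h) = (s 0 div s h) * N"
    proof -
      have "s h dvd s 0"
        using chain_dvd[of 0 h] Suc.prems by simp
      then obtain d where "s 0 = s h * d" by (auto elim: dvdE)
      then show ?thesis
        using s_pos[of h] Suc.prems pos by (simp add: sN)
    qed
    have sub: "Z * N + i < s 0 div s (Suc h)" if "Z < s 0 div s h" "i < N" for Z i
    proof -
      have "Z * N + i < Suc Z * N" using that(2) by simp
      also have "\<dots> \<le> (s 0 div s h) * N"
        using that(1) by (intro mult_le_mono1) simp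
      finally show ?thesis by (simp add: s0)
    qed
    have coarser: "cell m w h a = (X, Y)"
      if "a < ?n" "cell m w (Suc h) a = (X * N + i, Y * N + i')" "i < N" "i' < N" for a i i'
    proof -
      have "(Z * N + i) div N = Z" if "i < N" for Z i
        using that by simp
      then show ?thesis
        using that Suc.prems cell_uniform[of h a] cell_uniform[of "Suc h" a] w(3)
        unfolding w_def[symmetric] by (simp add: sN div_mult2_eq)
    qed
    show ?case
    proof (rule ccontr)
      assume neg: "\<not> ?case"
      \<comment> \<open>If every subcell contained a stack lower than h + 1, these stacks would have
        height exactly h, and there would be one for each of the \<open>N * N\<close>
        subcells.\<close>
      have "\<exists>a. a < ?n \<and> cell m w (Suc h) a = (X * N + fst ii, Y * N + snd ii) \<and> \<not> Suc h \<le> length (snd (e a))"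
        if "ii \<in> {..<N} \<times> {..<N}" for ii
        using neg sub[OF XY(1), of "fst ii"] sub[OF XY(2), of "snd ii"] that by (auto simp: mem_Times_iff)
      then obtain g where g: "\<And>ii. ii \<in> {..<N} \<times> {..<N} \<Longrightarrow> g ii < ?n \<and>
          cell m w (Suc h) (g ii) = (X * N + fst ii, Y * N + snd ii) \<and> \<not> Suc h \<le> length (snd (e (g ii)))"
        by metis
      have "card ({..<N} \<times> {..<N}) \<le> card {a. a < ?n \<and> cell m w h a = (X, Y) \<and> length (snd (e a)) = h}"
      proof (rule card_inj_on_le[of g])
        show "inj_on g ({..<N} \<times> {..<N})"
        proof (rule inj_onI)
          fix x y assume xy: "x \<in> {..<N} \<times> {..<N}" "y \<in> {..<N} \<times> {..<N}" "g x = g y"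
          then have "(X * N + fst x, Y * N + snd x) = (X * N + fst y, Y * N + snd y)"
            using g[OF xy(1)] g[OF xy(2)] by simp
          then show "x = y" by (simp add: prod_eq_iff)
        qed
        show "g ` ({..<N} \<times> {..<N}) \<subseteq> {a. a < ?n \<and> cell m w h a = (X, Y) \<and> length (snd (e a)) = h}"
        proof (rule image_subsetI)
          fix ii assume ii: "ii \<in> {..<N} \<times> {..<N}"
          have c: "cell m w h (g ii) = (X, Y)"
            using g[OF ii] ii by (intro coarser[of _ "fst ii" "snd ii"]) (auto simp: mem_Times_iff)
          then show "g ii \<in> {a. a < ?n \<and> cell m w h a = (X, Y) \<and> length (snd (e a)) = h}"
            using g[OF ii] high[of "g ii"] by simp
        qed
      qed simp
      also have "\<dots> \<le> K * s h"
        using Suc.prems high by (intro few) auto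
      \<comment> \<open>Here \<open>K * s h\<close> equals \<open>(N - 1) * N\<close>.\<close>
      also have "\<dots> < N * N"
        by (simp add: sN N_def algebra_simps)
      finally show False by simp
    qed
  qed
  from this[of m] obtain X Y where XY: "X < s 0" "Y < s 0"
    and high: "\<And>a. a < ?n \<Longrightarrow> cell m w m a = (X, Y) \<Longrightarrow> m \<le> length (snd (e a))"
    by (auto simp: s_m)
  \<comment> \<open>A level-m cell is a single pair, so this configuration is the one whose stack is
    too high.\<close>
  obtain a where a: "a < ?n" "pairs m w ! a = (X, Y)"
    using pairs_index[of "(X, Y)" w m] XY w(3) by auto
  then have "cell m w m a = (X, Y)"
    using cell_uniform[of m a] w(3) unfolding w_def[symmetric] by (simp add: s_m)
  then have "m \<le> dim I (fst (e a))"
    using high conf(2) a(1) by fastforce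
  then show False
    using dimk[OF conf(1)[OF a(1)]] by (simp add: m_def)
qed

theorem mainTheorem2:
  fixes k :: nat
  assumes "k \<ge> 1"
  shows "\<exists>(\<Sigma>::nat set) (\<Gamma>::nat set) (f :: nat list \<Rightarrow> nat list).
           finite \<Sigma> \<and> \<Sigma> \<noteq> {} \<and> finite \<Gamma> \<and> \<Gamma> \<noteq> {}
         \<and> polyregular \<Sigma> \<Gamma> f
         \<and> (\<lambda>n. real (growth \<Sigma> f n)) \<in> \<Theta>(\<lambda>n. real n ^ 2)
         \<and> \<not> (\<exists>I. k_pebble_computes k \<Sigma> \<Gamma> I f)"
proof (intro exI conjI)
  show "polyregular {..Suc k} {..Suc k} (interleave (Suc k))"
    by (rule polyregular_interleave)
  show "(\<lambda>n. real (growth {..Suc k} (interleave (Suc k)) n)) \<in> \<Theta>(\<lambda>n. real n ^ 2)"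
    by (simp add: growth_interleave power2_eq_square)
  show "\<not> (\<exists>I. k_pebble_computes k {..Suc k} {..Suc k} I (interleave (Suc k)))"
    using not_k_pebble_interleave by blast
qed auto

end
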